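(* Let $I\subseteq S=\mathbb{K}[x_1,\dots,x_n]$ be a monomial ideal with $|G(I)|\ge 2$. Then the following statements are equivalent: (1) $I$ has projective dimension $1$; (2) there exists an ordering $u_1,\ldots,u_r$ of the elements of $G(I)$ such that for each $2\le k\le r$ there exists some $1\le j_k<k$ such that $u_{j_k}$ divides $\operatorname{lcm}(u_i,u_k)$ for all $1\le i<k$; (3) there exists an ordering $u_1,\ldots,u_r$ of the elements of $G(I)$ such that for each $2\le k\le r$ the colon ideal $(u_1,\ldots,u_{k-1}):u_k$ is generated by a single monomial.
   Context: $S=\mathbb{K}[x_1,\dots,x_n]$ is the polynomial ring over a field $\mathbb{K}$. For a monomial ideal $I\subseteq S$, $G(I)$ denotes its set of minimal monomial generators, and here $r=|G(I)|$. The projective dimension of $I$ is that of $I$ as an $S$-module. *)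

theory Defs
  imports
    "HOL-Algebra.Module"
    "HOL-Algebra.Ideal"
    "HOL-Algebra.AbelCoset"
    "HOL-Library.Poly_Mapping"
    "HOL-Library.Extended_Nat"
begin

section \<open>Projective dimension of a module over a commutative ring\<close>

definition linear_maps ::
  "'r ring \<Rightarrow> ('r, 'm) module \<Rightarrow> ('r, 'n) module \<Rightarrow> ('m \<Rightarrow> 'n) set" where
  "linear_maps R M N =
    {f \<in> carrier M \<rightarrow> carrier N.
      (\<forall>x\<in>carrier M. \<forall>y\<in>carrier M. f (x \<oplus>\<^bsub>M\<^esub> y) = f x \<oplus>\<^bsub>N\<^esub> f y) \<and>
      (\<forall>a\<in>carrier R. \<forall>x\<in>carrier M. f (a \<odot>\<^bsub>M\<^esub> x) = a \<odot>\<^bsub>N\<^esub> f x)}"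

text \<open>
  Lifting property against surjections \<open>A \<rightarrow> B\<close>. A definition cannot quantify over types, so
  the types underlying \<open>A\<close> and \<open>B\<close> are fixed. This loses nothing: the canonical surjection from
  the free module on \<open>carrier P\<close> (finitely supported functions, of type \<open>'p \<Rightarrow> 'r\<close>) onto \<open>P\<close>
  is one of the surjections considered, so \<open>P\<close> is a direct summand of a free module and has
  the lifting property against surjections between modules over arbitrary types.
\<close>

definition projective_module :: "'r ring \<Rightarrow> ('r, 'p) module \<Rightarrow> bool" where
  "projective_module R P \<longleftrightarrow>
    Module.module R P \<and>
    (\<forall>(A :: ('r, 'p \<Rightarrow> 'r) module) (B :: ('r, 'p) module). \<forall>g\<in>linear_maps R A B. \<forall>f\<in>linear_maps R P B.
      Module.module R A \<longrightarrow> Module.module R B \<longrightarrow> g ` carrier A = carrier B \<longrightarrow>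
      (\<exists>h\<in>linear_maps R P A. \<forall>x\<in>carrier P. g (h x) = f x))"

text \<open>
  \<open>\<cdots> \<rightarrow> P 2 \<rightarrow> P 1 \<rightarrow> P 0 \<rightarrow> M \<rightarrow> 0\<close>, with maps \<open>\<delta> i : P (Suc i) \<rightarrow> P i\<close> and augmentation \<open>\<epsilon>\<close>.
\<close>

definition projective_resolution ::
  "'r ring \<Rightarrow> ('r, 'm) module \<Rightarrow> (nat \<Rightarrow> ('r, 'p) module) \<Rightarrow> (nat \<Rightarrow> 'p \<Rightarrow> 'p) \<Rightarrow> ('p \<Rightarrow> 'm) \<Rightarrow> bool" where
  "projective_resolution R M P \<delta> \<epsilon> \<longleftrightarrow>
    (\<forall>i. projective_module R (P i)) \<and>
    \<epsilon> \<in> linear_maps R (P 0) M \<and>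
    (\<forall>i. \<delta> i \<in> linear_maps R (P (Suc i)) (P i)) \<and>
    \<epsilon> ` carrier (P 0) = carrier M \<and>
    \<delta> 0 ` carrier (P 1) = a_kernel (P 0) M \<epsilon> \<and>
    (\<forall>i. \<delta> (Suc i) ` carrier (P (Suc (Suc i))) = a_kernel (P (Suc i)) (P i) (\<delta> i))"

text \<open>
  The terms of the resolutions are carried by subsets of the type \<open>'m \<times> nat \<Rightarrow> 'r\<close>. This loses
  nothing: if \<open>R\<close> is not trivial, that type has at least
  \<open>\<kappa> = max \<bar>M\<bar> (max \<bar>R\<bar> \<aleph>\<^sub>0)\<close> elements. The canonical free resolution of \<open>M\<close> and
  its syzygy modules have cardinality at most \<open>\<kappa>\<close>, and, if \<open>M\<close> has a projective resolution of
  length \<open>d\<close> anywhere, then the canonical one, cut off at its \<open>d\<close>-th syzygy module, is another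
  one by Schanuel's lemma. The infimum is \<open>\<infinity>\<close> if there is no finite resolution; the zero module
  gets the value \<open>0\<close>.
\<close>

definition projective_dimension :: "'r ring \<Rightarrow> ('r, 'm) module \<Rightarrow> enat" where
  "projective_dimension R M =
    Inf {enat d | d.
      \<exists>(P :: nat \<Rightarrow> ('r, 'm \<times> nat \<Rightarrow> 'r) module) \<delta> \<epsilon>.
        projective_resolution R M P \<delta> \<epsilon> \<and> (\<forall>i>d. carrier (P i) = {\<zero>\<^bsub>P i\<^esub>})}"

text \<open>An ideal as a module; the fields \<open>mult\<close> and \<open>one\<close> play no role in the locale \<open>module\<close>.\<close>

definition ideal_module :: "'r ring \<Rightarrow> 'r set \<Rightarrow> ('r, 'r) module" where
  "ideal_module R I =
    \<lparr>carrier = I, mult = mult R, one = one R, zero = zero R, add = add R, smult = mult R\<rparr>"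

definition colon_ideal :: "'r ring \<Rightarrow> 'r set \<Rightarrow> 'r \<Rightarrow> 'r set" where
  "colon_ideal R J u = {f \<in> carrier R. f \<otimes>\<^bsub>R\<^esub> u \<in> J}"


section \<open>Polynomials and monomial ideals\<close>

text \<open>
  Variables are indexed by a finite type \<open>'x\<close>, so \<open>n = CARD('x)\<close>. The multiplication of
  \<open>Poly_Mapping\<close> is convolution with respect to addition of exponents.
\<close>

type_synonym ('x, 'k) polynomial = "('x \<Rightarrow>\<^sub>0 nat) \<Rightarrow>\<^sub>0 'k"

definition polynomial_ring :: "('x::finite, 'k::field) polynomial ring" where
  "polynomial_ring = \<lparr>carrier = UNIV, mult = (*), one = 1, zero = 0, add = (+)\<rparr>"

definition monomial :: "('x::finite \<Rightarrow>\<^sub>0 nat) \<Rightarrow> ('x, 'k::field) polynomial" where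
  "monomial t = Poly_Mapping.single t 1"

definition monomials :: "('x::finite, 'k::field) polynomial set" where
  "monomials = range monomial"

lift_definition exponent_max :: "('x::finite \<Rightarrow>\<^sub>0 nat) \<Rightarrow> ('x \<Rightarrow>\<^sub>0 nat) \<Rightarrow> ('x \<Rightarrow>\<^sub>0 nat)"
  is "\<lambda>s t x. max (s x) (t x)"
  by simp

text \<open>Meaningful for monomials \<open>u\<close> and \<open>v\<close> only.\<close>

definition monomial_lcm ::
  "('x::finite, 'k::field) polynomial \<Rightarrow> ('x, 'k) polynomial \<Rightarrow> ('x, 'k) polynomial" where
  "monomial_lcm u v =
    monomial (exponent_max (the_inv monomial u) (the_inv monomial v))"

definition monomial_ideal :: "('x::finite, 'k::field) polynomial set \<Rightarrow> bool" where
  "monomial_ideal I \<longleftrightarrow> (\<exists>A\<subseteq>monomials. I = Idl\<^bsub>polynomial_ring\<^esub> A)"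

definition minimal_monomial_generating_set ::
  "('x::finite, 'k::field) polynomial set \<Rightarrow> ('x, 'k) polynomial set \<Rightarrow> bool" where
  "minimal_monomial_generating_set I A \<longleftrightarrow>
    A \<subseteq> monomials \<and> Idl\<^bsub>polynomial_ring\<^esub> A = I \<and>
    (\<forall>B. B \<subset> A \<longrightarrow> Idl\<^bsub>polynomial_ring\<^esub> B \<noteq> I)"

text \<open>Existence and uniqueness for monomial ideals are proved below.\<close>

definition minimal_monomial_generators ::
  "('x::finite, 'k::field) polynomial set \<Rightarrow> ('x, 'k) polynomial set" where
  "minimal_monomial_generators I = (THE A. minimal_monomial_generating_set I A)"


section \<open>Well-definedness\<close>

lemma cring_polynomial_ring: "cring (polynomial_ring :: ('x::finite, 'k::field) polynomial ring)"
proof (rule cringI)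
  show "abelian_group (polynomial_ring :: ('x, 'k) polynomial ring)"
    by (rule abelian_groupI)
      (auto simp: polynomial_ring_def algebra_simps intro: right_minus)
  show "comm_monoid (polynomial_ring :: ('x, 'k) polynomial ring)"
    by (rule comm_monoidI) (auto simp: polynomial_ring_def algebra_simps)
qed (simp add: polynomial_ring_def algebra_simps)

lemma module_ideal_module:
  assumes "cring R" "ideal I R"
  shows "Module.module R (ideal_module R I)"
proof -
  interpret cring R by fact
  interpret ideal I R by fact
  have "\<exists>y\<in>I. y \<oplus>\<^bsub>R\<^esub> x = \<zero>\<^bsub>R\<^esub>" if "x \<in> I" for x
    using that a_inv_closed l_neg a_Hcarr by metis
  then have "abelian_group (ideal_module R I)"
    by (intro abelian_groupI) (auto simp: ideal_module_def a_ac)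
  then show ?thesis
    by (rule moduleI[OF assms(1)])
      (auto simp: ideal_module_def I_l_closed m_assoc l_distr r_distr)
qed

lemma inj_monomial: "inj (monomial :: ('x::finite \<Rightarrow>\<^sub>0 nat) \<Rightarrow> ('x, 'k::field) polynomial)"
  unfolding monomial_def inj_def
  by (metis lookup_single_eq lookup_single_not_eq zero_neq_one)

lemma monomial_lcm_monomial:
  "monomial_lcm (monomial s :: ('x::finite, 'k::field) polynomial) (monomial t) =
    monomial (exponent_max s t)"
  by (simp add: monomial_lcm_def the_inv_f_f[OF inj_monomial])

lemma ideal_generated_by_monomials:
  fixes T :: "('x::finite \<Rightarrow>\<^sub>0 nat) set"
  shows "Idl\<^bsub>polynomial_ring\<^esub> (monomial ` T :: ('x, 'k::field) polynomial set) =
    {f. \<forall>s\<in>Poly_Mapping.keys f. \<exists>t\<in>T. \<exists>d. s = t + d}" (is "?L = ?R")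
proof -
  interpret S: cring "polynomial_ring :: ('x, 'k) polynomial ring"
    by (rule cring_polynomial_ring)
  have minus: "\<ominus>\<^bsub>polynomial_ring\<^esub> f = - f" for f :: "('x, 'k) polynomial"
    by (rule S.minus_equality) (auto simp: polynomial_ring_def)
  have add: "f + g \<in> ?R" if "f \<in> ?R" "g \<in> ?R" for f g :: "('x, 'k) polynomial"
    using that Poly_Mapping.keys_add[of f g] by blast
  have mult: "g * f \<in> ?R" if f: "f \<in> ?R" for f g :: "('x, 'k) polynomial"
  proof (clarify)
    fix s assume "s \<in> Poly_Mapping.keys (g * f)"
    then obtain a b where ab: "s = a + b" "b \<in> Poly_Mapping.keys f"
      using keys_mult[of g f] by blast
    then obtain t d where "t \<in> T" "b = t + d"
      using f by blast
    then show "\<exists>t\<in>T. \<exists>d. s = t + d"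
      using ab by (intro bexI[of _ t] exI[of _ "a + d"]) (simp_all add: ac_simps)
  qed
  have uminus: "- f \<in> ?R" if "f \<in> ?R" for f :: "('x, 'k) polynomial"
    using mult[OF that, of "- 1"] by simp
  have zero: "(0 :: ('x, 'k) polynomial) \<in> ?R"
    by simp
  have "ideal ?R polynomial_ring"
  proof (rule idealI)
    show "ring (polynomial_ring :: ('x, 'k) polynomial ring)" ..
    show "subgroup ?R (add_monoid polynomial_ring)"
    proof (rule subgroup.intro)
      show "?R \<subseteq> carrier (add_monoid polynomial_ring)"
        by (simp add: polynomial_ring_def)
      show "f \<otimes>\<^bsub>add_monoid polynomial_ring\<^esub> g \<in> ?R" if "f \<in> ?R" "g \<in> ?R" for f g
        using add[OF that] by (simp only: polynomial_ring_def monoid.simps ring_record_simps)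
      show "\<one>\<^bsub>add_monoid polynomial_ring\<^esub> \<in> ?R"
        using zero by (simp only: polynomial_ring_def monoid.simps ring_record_simps)
      show "inv\<^bsub>add_monoid polynomial_ring\<^esub> f \<in> ?R" if "f \<in> ?R" for f
        using uminus[OF that] minus[of f] by (simp only: a_inv_def)
    qed
  next
    fix f g :: "('x, 'k) polynomial"
    assume "f \<in> ?R"
    then have *: "g * f \<in> ?R" by (rule mult)
    show "g \<otimes>\<^bsub>polynomial_ring\<^esub> f \<in> ?R" "f \<otimes>\<^bsub>polynomial_ring\<^esub> g \<in> ?R"
      using * by (simp_all only: polynomial_ring_def monoid.simps mult.commute[of f g])
  qed
  moreover have "monomial ` T \<subseteq> ?R"
    by (force simp: monomial_def intro: exI[of _ 0])
  ultimately have "?L \<subseteq> ?R"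
    by (rule S.genideal_minimal)
  moreover have "f \<in> ?L" if "f \<in> ?R" for f :: "('x, 'k) polynomial"
  proof -
    interpret L: ideal ?L "polynomial_ring :: ('x, 'k) polynomial ring"
      by (rule S.genideal_ideal) (simp add: polynomial_ring_def)
    have single_mem: "Poly_Mapping.single s c \<in> ?L" if s: "s \<in> Poly_Mapping.keys f" for s c
    proof -
      obtain t d where td: "t \<in> T" "s = t + d"
        using \<open>f \<in> ?R\<close> s by blast
      have "monomial t \<in> ?L"
        using S.genideal_self[of "monomial ` T"] td by (auto simp: polynomial_ring_def)
      then have "Poly_Mapping.single d c \<otimes>\<^bsub>polynomial_ring\<^esub> monomial t \<in> ?L"
        by (rule L.I_l_closed) (simp add: polynomial_ring_def)
      then show ?thesis
        by (simp add: polynomial_ring_def monomial_def mult_single td add.commute)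
    qed
    have "(\<Sum>s\<in>K. Poly_Mapping.single s (Poly_Mapping.lookup f s)) \<in> ?L"
      if "finite K" "K \<subseteq> Poly_Mapping.keys f" for K
      using that
    proof (induction K)
      case empty
      show ?case using L.zero_closed by (simp add: polynomial_ring_def)
    next
      case (insert s K)
      then show ?case
        using L.a_closed[OF single_mem] by (auto simp: polynomial_ring_def)
    qed
    then have "(\<Sum>s\<in>Poly_Mapping.keys f. Poly_Mapping.single s (Poly_Mapping.lookup f s)) \<in> ?L"
      by simp
    moreover have "(\<Sum>s\<in>Poly_Mapping.keys f. Poly_Mapping.single s (Poly_Mapping.lookup f s)) = f"
      by (rule poly_mapping_eqI) (simp add: lookup_sum lookup_single when_def in_keys_iff)
    ultimately show ?thesis by (simp only:)
  qed
  ultimately show ?thesis by blast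
qed

lemma ex1_minimal_monomial_generating_set:
  fixes I :: "('x::finite, 'k::field) polynomial set"
  assumes "monomial_ideal I"
  shows "\<exists>!A. minimal_monomial_generating_set I A"
proof -
  let ?mon = "monomial :: _ \<Rightarrow> ('x, 'k) polynomial"
  define T where "T = {t. ?mon t \<in> I \<and> (\<forall>s d. ?mon s \<in> I \<longrightarrow> t = s + d \<longrightarrow> d = 0)}"
  have gen_iff: "?mon s \<in> Idl\<^bsub>polynomial_ring\<^esub> (?mon ` U) \<longleftrightarrow> (\<exists>t\<in>U. \<exists>d. s = t + d)" for s U
    unfolding ideal_generated_by_monomials by (simp add: monomial_def)
  have ge: "?mon ` T \<subseteq> A" if A: "A \<subseteq> monomials" "Idl\<^bsub>polynomial_ring\<^esub> A = I" for A
  proof -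
    obtain U where U: "A = ?mon ` U"
      using A(1) unfolding monomials_def by (meson subset_imageE)
    have mem: "?mon s \<in> I \<longleftrightarrow> (\<exists>t\<in>U. \<exists>d. s = t + d)" for s
      using gen_iff[of s U] A(2) U by simp
    have "T \<subseteq> U"
    proof
      fix t assume t: "t \<in> T"
      then obtain s d where s: "s \<in> U" "t = s + d"
        using mem unfolding T_def by blast
      have "?mon s \<in> I"
        using mem s(1) by (metis add.right_neutral)
      then have "d = 0" using t s unfolding T_def by blast
      then show "t \<in> U" using s by simp
    qed
    then show ?thesis using U by blast
  qed
  obtain U where I: "I = Idl\<^bsub>polynomial_ring\<^esub> (?mon ` U)"
    using assms unfolding monomial_ideal_def monomials_def by (metis subset_imageE)
  have below: "\<exists>t\<in>T. \<exists>d. s = t + d" if "?mon s \<in> I" for s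
    using that
  proof (induction "\<Sum>x\<in>UNIV. Poly_Mapping.lookup s x" arbitrary: s rule: less_induct)
    case less
    show ?case
    proof (cases "s \<in> T")
      case True
      then show ?thesis by (metis add.right_neutral)
    next
      case False
      then obtain r d where r: "?mon r \<in> I" "s = r + d" "d \<noteq> 0"
        using less.prems unfolding T_def by blast
      obtain x where "Poly_Mapping.lookup d x \<noteq> 0"
        using r(3) by (metis poly_mapping_eqI lookup_zero)
      then have "(\<Sum>x\<in>UNIV. Poly_Mapping.lookup d x) > 0"
        by (meson finite_UNIV iso_tuple_UNIV_I not_gr_zero sum_eq_0_iff)
      then have "(\<Sum>x\<in>UNIV. Poly_Mapping.lookup r x) < (\<Sum>x\<in>UNIV. Poly_Mapping.lookup s x)"
        by (simp add: r lookup_add sum.distrib)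
      then show ?thesis
        using less.hyps[OF _ r(1)] r(2) by (metis add.assoc)
    qed
  qed
  have gen: "Idl\<^bsub>polynomial_ring\<^esub> (?mon ` T) = I"
  proof -
    have "\<exists>t\<in>T. \<exists>d. s = t + d" if "u \<in> U" "s = u + d" for s u d
    proof -
      have "?mon s \<in> I" using that gen_iff[of s U] I by auto
      then show ?thesis by (rule below)
    qed
    moreover have "\<exists>u\<in>U. \<exists>d. s = u + d" if "t \<in> T" "s = t + d" for s t d
    proof -
      have "?mon t \<in> I" using that unfolding T_def by simp
      then obtain u e where "u \<in> U" "t = u + e" using gen_iff[of t U] I by auto
      then show ?thesis using that by (metis add.assoc)
    qed
    ultimately show ?thesis
      unfolding I ideal_generated_by_monomials by blast
  qed
  show ?thesis
  proof (rule ex1I)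
    show "minimal_monomial_generating_set I (?mon ` T)"
      using gen ge unfolding minimal_monomial_generating_set_def monomials_def by blast
    show "A = ?mon ` T" if "minimal_monomial_generating_set I A" for A
      using that gen ge[of A] unfolding minimal_monomial_generating_set_def by blast
  qed
qed

end

theory Submission
  imports Defs
begin

text \<open>
  Let \<open>T\<close> be the set of exponents of the minimal generators, and let \<open>K\<close> be the kernel of the
  surjection \<open>S\<^sup>T \<rightarrow> I\<close> that sends the basis vector \<open>e\<^sub>t\<close> to the monomial \<open>x\<^sup>t\<close>. A pair \<open>e = (a, b)\<close>
  of exponents with least common multiple \<open>l\<close> has the syzygy
  \<open>s\<^sub>e = x\<^bsup>l - a\<^esup> e\<^sub>a - x\<^bsup>l - b\<^esup> e\<^sub>b\<close>, so a set \<open>E\<close> of such pairs, read as a graph on \<open>T\<close>, defines a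
  map \<open>S\<^sup>E \<rightarrow> K\<close>. The theorem translates properties of this map into properties of the graph.

  The map is onto if, for every monomial \<open>m\<close>, the vertices that divide \<open>m\<close> are connected by edges
  both of whose ends divide \<open>m\<close> (\<open>syzygy_in_edge_span\<close>). Choose \<open>E\<close> minimal with this property.
  Then no relation between the syzygies \<open>s\<^sub>e\<close> has a coefficient with a nonzero constant term
  (\<open>relation_constant_coeff_eq_0\<close>): the edge with that coefficient could be replaced by a path.

  If \<open>I\<close> has projective dimension at most \<open>1\<close>, then \<open>S\<^sup>E \<rightarrow> K\<close> splits by Schanuel's argument
  (\<open>kernel_splits_if_projective_dimension_le_1\<close>). Subtracting from each basis vector of \<open>S\<^sup>E\<close> the
  image of its syzygy under the splitting gives a matrix that fixes every relation and whose rows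
  are relations. Its entries have no constant term, so it raises the lowest degree that
  occurs in a nonzero relation; hence every relation is zero
  (\<open>edge_independent_if_splitting\<close>). Independent syzygies cannot contain those of a cycle, so \<open>E\<close>
  is a forest, in fact a tree. List its vertices so that each new vertex \<open>b\<close> is joined by an edge
  to an earlier one, \<open>a\<close>. For an earlier vertex \<open>i\<close> there is a path from \<open>i\<close> to \<open>b\<close> through divisors
  of \<open>lcm(i, b)\<close>; it must use the edge from \<open>a\<close> to \<open>b\<close>, since otherwise there would be a cycle.
  So \<open>a\<close> divides \<open>lcm(i, b)\<close>, which is the divisibility condition on the
  ordering (\<open>ex_tree_ordering_if_forest\<close>).

  Conversely, for an ordering with that condition take the graph that joins each generator after
  the first to the earlier one that the condition assigns to it. It is connected below every
  monomial, and its syzygies are independent because their matrix is triangular; this gives a free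
  resolution of length \<open>1\<close>. Dimension \<open>0\<close> is impossible when there are two incomparable
  generators (\<open>projective_dimension_ne_0\<close>). Finally, the colon ideal is generated by the quotients
  of \<open>lcm(u\<^sub>i, u\<^sub>k)\<close> by \<open>u\<^sub>k\<close>, so it is generated by one monomial exactly if one of these
  quotients divides all others (\<open>colon_ideal_principal_iff\<close>); hence one and the same ordering
  serves both conditions.
\<close>

section \<open>Free modules and the lifting property\<close>

definition free_module :: "'r ring \<Rightarrow> 'b set \<Rightarrow> ('r, 'b \<Rightarrow> 'r) module" where
  "free_module R X =
    \<lparr>carrier = {c \<in> UNIV \<rightarrow> carrier R. finite {x. c x \<noteq> \<zero>\<^bsub>R\<^esub>} \<and> {x. c x \<noteq> \<zero>\<^bsub>R\<^esub>} \<subseteq> X},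
     mult = undefined, one = undefined, zero = (\<lambda>_. \<zero>\<^bsub>R\<^esub>),
     add = (\<lambda>c d x. c x \<oplus>\<^bsub>R\<^esub> d x), smult = (\<lambda>a c x. a \<otimes>\<^bsub>R\<^esub> c x)\<rparr>"

definition unit_vector :: "'r ring \<Rightarrow> 'b \<Rightarrow> 'b \<Rightarrow> 'r" where
  "unit_vector R x = (\<lambda>y. if y = x then \<one>\<^bsub>R\<^esub> else \<zero>\<^bsub>R\<^esub>)"

definition linear_extension ::
  "'r ring \<Rightarrow> ('r, 'm) module \<Rightarrow> ('b \<Rightarrow> 'm) \<Rightarrow> ('b \<Rightarrow> 'r) \<Rightarrow> 'm" where
  "linear_extension R M a c = (\<Oplus>\<^bsub>M\<^esub>x\<in>{x. c x \<noteq> \<zero>\<^bsub>R\<^esub>}. c x \<odot>\<^bsub>M\<^esub> a x)"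

lemma free_module_simps:
  "zero (free_module R X) = (\<lambda>_. \<zero>\<^bsub>R\<^esub>)"
  "c \<oplus>\<^bsub>free_module R X\<^esub> d = (\<lambda>x. c x \<oplus>\<^bsub>R\<^esub> d x)"
  "a \<odot>\<^bsub>free_module R X\<^esub> c = (\<lambda>x. a \<otimes>\<^bsub>R\<^esub> c x)"
  "c \<in> carrier (free_module R X) \<longleftrightarrow>
    (\<forall>x. c x \<in> carrier R) \<and> finite {x. c x \<noteq> \<zero>\<^bsub>R\<^esub>} \<and> {x. c x \<noteq> \<zero>\<^bsub>R\<^esub>} \<subseteq> X"
  by (auto simp: free_module_def)

lemma module_free_module:
  fixes R (structure) and X :: "'b set"
  assumes "cring R"
  shows "Module.module R (free_module R X)"
proof -
  interpret cring R by fact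
  show ?thesis
  proof (rule moduleI)
  have add: "finite {x. c x \<oplus> d x \<noteq> \<zero>} \<and> {x. c x \<oplus> d x \<noteq> \<zero>} \<subseteq> X"
    if "finite {x. c x \<noteq> \<zero>}" "{x. c x \<noteq> \<zero>} \<subseteq> X"
       "finite {x. d x \<noteq> \<zero>}" "{x. d x \<noteq> \<zero>} \<subseteq> X" for c d :: "'b \<Rightarrow> 'a"
  proof -
    have "{x. c x \<oplus> d x \<noteq> \<zero>} \<subseteq> {x. c x \<noteq> \<zero>} \<union> {x. d x \<noteq> \<zero>}"
      by auto
    then show ?thesis
      using that by (meson finite_Un finite_subset le_sup_iff order_trans)
  qed
  have smult: "finite {x. a \<otimes> c x \<noteq> \<zero>} \<and> {x. a \<otimes> c x \<noteq> \<zero>} \<subseteq> X"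
    if "finite {x. c x \<noteq> \<zero>}" "{x. c x \<noteq> \<zero>} \<subseteq> X" "a \<in> carrier R" for a and c :: "'b \<Rightarrow> 'a"
  proof -
    have "{x. a \<otimes> c x \<noteq> \<zero>} \<subseteq> {x. c x \<noteq> \<zero>}"
      using that by auto
    then show ?thesis
      using that by (meson finite_subset order_trans)
  qed
  show "cring R" ..
  show "abelian_group (free_module R X)"
  proof (rule abelian_groupI)
    fix c :: "'b \<Rightarrow> 'a" assume c: "c \<in> carrier (free_module R X)"
    have "{x. \<ominus> c x \<noteq> \<zero>} = {x. c x \<noteq> \<zero>}"
      using c by (auto simp: free_module_simps)
    then have "(\<lambda>x. \<ominus> c x) \<in> carrier (free_module R X)"
      using c by (simp add: free_module_simps)
    then show "\<exists>d\<in>carrier (free_module R X).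
        d \<oplus>\<^bsub>free_module R X\<^esub> c = \<zero>\<^bsub>free_module R X\<^esub>"
      using c by (intro bexI[of _ "\<lambda>x. \<ominus> c x"]) (simp_all add: free_module_simps l_neg)
  next
    fix c d :: "'b \<Rightarrow> 'a"
    assume "c \<in> carrier (free_module R X)" "d \<in> carrier (free_module R X)"
    then show "c \<oplus>\<^bsub>free_module R X\<^esub> d \<in> carrier (free_module R X)"
      using add[of c d] by (simp add: free_module_simps)
  qed (simp_all add: free_module_simps a_ac)
  fix a :: 'a and c :: "'b \<Rightarrow> 'a"
  assume "a \<in> carrier R" "c \<in> carrier (free_module R X)"
  then show "a \<odot>\<^bsub>free_module R X\<^esub> c \<in> carrier (free_module R X)"
    using smult[of c a] by (simp add: free_module_simps)
  qed (simp_all add: free_module_simps l_distr r_distr m_assoc)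
qed

lemma linear_mapsD:
  assumes "f \<in> linear_maps R M N"
  shows "x \<in> carrier M \<Longrightarrow> f x \<in> carrier N"
    and "x \<in> carrier M \<Longrightarrow> y \<in> carrier M \<Longrightarrow> f (x \<oplus>\<^bsub>M\<^esub> y) = f x \<oplus>\<^bsub>N\<^esub> f y"
    and "a \<in> carrier R \<Longrightarrow> x \<in> carrier M \<Longrightarrow> f (a \<odot>\<^bsub>M\<^esub> x) = a \<odot>\<^bsub>N\<^esub> f x"
  using assms by (auto simp: linear_maps_def)

lemma linear_mapsI:
  assumes "\<And>x. x \<in> carrier M \<Longrightarrow> f x \<in> carrier N"
    and "\<And>x y. x \<in> carrier M \<Longrightarrow> y \<in> carrier M \<Longrightarrow> f (x \<oplus>\<^bsub>M\<^esub> y) = f x \<oplus>\<^bsub>N\<^esub> f y"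
    and "\<And>a x. a \<in> carrier R \<Longrightarrow> x \<in> carrier M \<Longrightarrow> f (a \<odot>\<^bsub>M\<^esub> x) = a \<odot>\<^bsub>N\<^esub> f x"
  shows "f \<in> linear_maps R M N"
  using assms by (auto simp: linear_maps_def)

lemma linear_maps_comp:
  assumes "f \<in> linear_maps R M N" "g \<in> linear_maps R N L"
  shows "(\<lambda>x. g (f x)) \<in> linear_maps R M L"
  by (rule linear_mapsI) (simp_all add: linear_mapsD[OF assms(1)] linear_mapsD[OF assms(2)])

lemma linear_maps_zero:
  assumes "Module.module R M" "Module.module R N" "f \<in> linear_maps R M N"
  shows "f \<zero>\<^bsub>M\<^esub> = \<zero>\<^bsub>N\<^esub>"
proof -
  interpret M: Module.module R M by fact
  interpret N: Module.module R N by fact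
  have "f \<zero>\<^bsub>M\<^esub> = f (\<zero>\<^bsub>R\<^esub> \<odot>\<^bsub>M\<^esub> \<zero>\<^bsub>M\<^esub>)"
    by simp
  also have "\<dots> = \<zero>\<^bsub>N\<^esub>"
    using linear_mapsD[OF assms(3)] by (metis M.zero_closed M.R.zero_closed N.smult_l_null)
  finally show ?thesis .
qed

lemma linear_maps_minus:
  assumes "Module.module R M" "Module.module R N" "f \<in> linear_maps R M N"
    and "x \<in> carrier M" "y \<in> carrier M"
  shows "f (x \<ominus>\<^bsub>M\<^esub> y) = f x \<ominus>\<^bsub>N\<^esub> f y"
proof -
  interpret M: Module.module R M by fact
  interpret N: Module.module R N by fact
  note f = linear_mapsD[OF assms(3)]
  have "f (\<ominus>\<^bsub>M\<^esub> y) = f ((\<ominus>\<^bsub>R\<^esub> \<one>\<^bsub>R\<^esub>) \<odot>\<^bsub>M\<^esub> y)"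
    using assms(5) M.smult_l_minus[of "\<one>\<^bsub>R\<^esub>" y] by simp
  also have "\<dots> = \<ominus>\<^bsub>N\<^esub> f y"
    using assms(5) N.smult_l_minus[of "\<one>\<^bsub>R\<^esub>" "f y"] by (simp add: f)
  finally show ?thesis
    using assms(4,5) by (simp add: a_minus_def f)
qed

lemma linear_maps_inj_on:
  assumes M: "Module.module R M" and N: "Module.module R N" and f: "f \<in> linear_maps R M N"
    and ker: "\<And>x. x \<in> carrier M \<Longrightarrow> f x = \<zero>\<^bsub>N\<^esub> \<Longrightarrow> x = \<zero>\<^bsub>M\<^esub>"
  shows "inj_on f (carrier M)"
proof (rule inj_onI)
  interpret M: Module.module R M by fact
  interpret N: Module.module R N by fact
  fix x y assume xy: "x \<in> carrier M" "y \<in> carrier M" "f x = f y"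
  have "f (x \<ominus>\<^bsub>M\<^esub> y) = \<zero>\<^bsub>N\<^esub>"
    using xy linear_maps_minus[OF M N f] linear_mapsD(1)[OF f]
    by (simp add: N.r_neg a_minus_def)
  then have "x \<ominus>\<^bsub>M\<^esub> y = \<zero>\<^bsub>M\<^esub>" using xy by (intro ker) simp_all
  then have "(x \<ominus>\<^bsub>M\<^esub> y) \<oplus>\<^bsub>M\<^esub> y = y" using xy by simp
  then show "x = y" using xy by (simp add: a_minus_def M.a_assoc M.l_neg)
qed

lemma linear_extension_superset:
  assumes "Module.module R M" "a \<in> X \<rightarrow> carrier M" "c \<in> carrier (free_module R X)"
    and "finite S" "{x. c x \<noteq> \<zero>\<^bsub>R\<^esub>} \<subseteq> S" "S \<subseteq> X"
  shows "linear_extension R M a c = (\<Oplus>\<^bsub>M\<^esub>x\<in>S. c x \<odot>\<^bsub>M\<^esub> a x)"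
proof -
  interpret M: Module.module R M by fact
  show ?thesis
    unfolding linear_extension_def
  proof (rule M.add.finprod_mono_neutral_cong_left)
    show "c x \<odot>\<^bsub>M\<^esub> a x = \<zero>\<^bsub>M\<^esub>" if "x \<in> S - {x. c x \<noteq> \<zero>\<^bsub>R\<^esub>}" for x
      using assms that by (auto simp: Pi_iff)
    show "(\<lambda>x. c x \<odot>\<^bsub>M\<^esub> a x) \<in> S \<rightarrow> carrier M"
      using assms(2,3,6) by (auto simp: Pi_iff subset_eq free_module_simps)
  qed (use assms in auto)
qed

lemma linear_extension_linear:
  assumes "Module.module R M" "a \<in> X \<rightarrow> carrier M"
  shows "linear_extension R M a \<in> linear_maps R (free_module R X) M"
proof (rule linear_mapsI)
  interpret M: Module.module R M by fact
  note sup = linear_extension_superset[OF assms]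
  have term_closed: "c x \<odot>\<^bsub>M\<^esub> a x \<in> carrier M"
    if "c \<in> carrier (free_module R X)" "x \<in> X" for c x
    using assms(2) that by (auto simp: free_module_simps)
  interpret F: Module.module R "free_module R X"
    by (rule module_free_module[OF M.R.is_cring])
  fix c assume c: "c \<in> carrier (free_module R X)"
  let ?C = "{x. c x \<noteq> \<zero>\<^bsub>R\<^esub>}"
  have C: "finite ?C" "?C \<subseteq> X" "\<And>x. c x \<in> carrier R"
    using c by (auto simp: free_module_simps)
  show "linear_extension R M a c \<in> carrier M"
    unfolding linear_extension_def using c C by (intro M.finsum_closed) (auto intro!: term_closed)
  {
    fix d assume d: "d \<in> carrier (free_module R X)"
    let ?D = "{x. d x \<noteq> \<zero>\<^bsub>R\<^esub>}"
    have D: "finite ?D" "?D \<subseteq> X" "\<And>x. d x \<in> carrier R"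
      using d by (auto simp: free_module_simps)
    let ?S = "?C \<union> ?D"
    have cd: "c \<oplus>\<^bsub>free_module R X\<^esub> d \<in> carrier (free_module R X)"
      using c d by simp
    have S: "finite ?S" "?S \<subseteq> X" using C D by auto
    have "linear_extension R M a (c \<oplus>\<^bsub>free_module R X\<^esub> d) =
        (\<Oplus>\<^bsub>M\<^esub>x\<in>?S. (c x \<oplus>\<^bsub>R\<^esub> d x) \<odot>\<^bsub>M\<^esub> a x)"
      by (subst sup[OF cd S(1) _ S(2)]) (auto simp: free_module_simps)
    also have "\<dots> = (\<Oplus>\<^bsub>M\<^esub>x\<in>?S. c x \<odot>\<^bsub>M\<^esub> a x \<oplus>\<^bsub>M\<^esub> d x \<odot>\<^bsub>M\<^esub> a x)"
      using S assms(2) C D term_closed[OF c] term_closed[OF d]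
      by (intro M.finsum_cong') (auto intro!: M.smult_l_distr)
    also have "\<dots> = (\<Oplus>\<^bsub>M\<^esub>x\<in>?S. c x \<odot>\<^bsub>M\<^esub> a x) \<oplus>\<^bsub>M\<^esub> (\<Oplus>\<^bsub>M\<^esub>x\<in>?S. d x \<odot>\<^bsub>M\<^esub> a x)"
      using S term_closed[OF c] term_closed[OF d] by (intro M.finsum_addf) auto
    also have "\<dots> = linear_extension R M a c \<oplus>\<^bsub>M\<^esub> linear_extension R M a d"
      using sup[OF c S(1) _ S(2)] sup[OF d S(1) _ S(2)] by auto
    finally show "linear_extension R M a (c \<oplus>\<^bsub>free_module R X\<^esub> d) =
      linear_extension R M a c \<oplus>\<^bsub>M\<^esub> linear_extension R M a d" .
  next
    fix r assume r: "r \<in> carrier R"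
    have rc: "r \<odot>\<^bsub>free_module R X\<^esub> c \<in> carrier (free_module R X)"
      using r c by simp
    have "linear_extension R M a (r \<odot>\<^bsub>free_module R X\<^esub> c) =
        (\<Oplus>\<^bsub>M\<^esub>x\<in>?C. (r \<otimes>\<^bsub>R\<^esub> c x) \<odot>\<^bsub>M\<^esub> a x)"
      using r by (subst sup[OF rc C(1) _ C(2)]) (auto simp: free_module_simps)
    also have "\<dots> = (\<Oplus>\<^bsub>M\<^esub>x\<in>?C. r \<odot>\<^bsub>M\<^esub> (c x \<odot>\<^bsub>M\<^esub> a x))"
      using r C assms(2) term_closed[OF c]
      by (intro M.finsum_cong') (auto intro!: M.smult_assoc1)
    also have "\<dots> = r \<odot>\<^bsub>M\<^esub> linear_extension R M a c"
      unfolding linear_extension_def using C r term_closed[OF c]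
      by (intro M.finsum_smult_ldistr[symmetric]) auto
    finally show "linear_extension R M a (r \<odot>\<^bsub>free_module R X\<^esub> c) =
      r \<odot>\<^bsub>M\<^esub> linear_extension R M a c" .
  }
qed

lemma linear_extension_unit_vector:
  assumes "Module.module R M" "a \<in> X \<rightarrow> carrier M" "x \<in> X" 
  shows "linear_extension R M a (unit_vector R x) = a x"
    and "unit_vector R x \<in> carrier (free_module R X)"
proof -
  interpret M: Module.module R M by fact
  have "{y. unit_vector R x y \<noteq> \<zero>\<^bsub>R\<^esub>} \<subseteq> {x}"
    by (auto simp: unit_vector_def)
  then show *: "unit_vector R x \<in> carrier (free_module R X)"
    using assms(3) by (auto simp: free_module_simps finite_subset unit_vector_def)
  have ax: "a x \<in> carrier M" using assms by auto
  have "linear_extension R M a (unit_vector R x) = 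
      (\<Oplus>\<^bsub>M\<^esub>y\<in>{x}. unit_vector R x y \<odot>\<^bsub>M\<^esub> a y)"
    using assms by (intro linear_extension_superset[OF assms(1,2) *])
      (auto simp: unit_vector_def)
  also have "\<dots> = a x"
    using ax by (simp add: unit_vector_def)
  finally show "linear_extension R M a (unit_vector R x) = a x" .
qed

text \<open>
  Induction on the support, splitting off one coordinate at a time, avoids writing a vector as
  a \<open>finsum\<close> of unit vectors in a function space.
\<close>
lemma linear_maps_eq_if_eq_on_unit_vectors:
  assumes N: "Module.module R N"
    and f: "f \<in> linear_maps R (free_module R X) N" and g: "g \<in> linear_maps R (free_module R X) N"
    and eq: "\<And>x. x \<in> X \<Longrightarrow> f (unit_vector R x) = g (unit_vector R x)"
    and c: "c \<in> carrier (free_module R X)"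
  shows "f c = g c"
proof -
  interpret N: Module.module R N by fact
  note F = module_free_module[OF N.R.is_cring, of X]
  interpret F: Module.module R "free_module R X" by (rule F)
  have "finite {x. c x \<noteq> \<zero>\<^bsub>R\<^esub>}" using c by (simp add: free_module_simps)
  then show ?thesis
    using c
  proof (induction "{x. c x \<noteq> \<zero>\<^bsub>R\<^esub>}" arbitrary: c rule: finite_induct)
    case empty
    then have "c = \<zero>\<^bsub>free_module R X\<^esub>" by (auto simp: free_module_simps)
    then show ?case
      using linear_maps_zero[OF F N f] linear_maps_zero[OF F N g] by simp
  next
    case (insert x S)
    have cR: "c y \<in> carrier R" for y using insert.prems by (simp add: free_module_simps)
    have x: "x \<in> X" using insert.hyps(4) insert.prems by (auto simp: free_module_simps)
    let ?d = "\<lambda>y. if y = x then \<zero>\<^bsub>R\<^esub> else c y"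
    have S: "S = {y. ?d y \<noteq> \<zero>\<^bsub>R\<^esub>}"
      using insert.hyps by auto
    have d: "?d \<in> carrier (free_module R X)"
      using S insert.hyps insert.prems by (auto simp: free_module_simps)
    have e: "unit_vector R x \<in> carrier (free_module R X)"
      using linear_extension_unit_vector(2)[OF F _ x, of "unit_vector R"] x
      by (auto simp: free_module_simps unit_vector_def intro: finite_subset[of _ "{x}"])
    have split: "h c = h ?d \<oplus>\<^bsub>N\<^esub> c x \<odot>\<^bsub>N\<^esub> h (unit_vector R x)"
      if h: "h \<in> linear_maps R (free_module R X) N" for h
    proof -
      have "c = ?d \<oplus>\<^bsub>free_module R X\<^esub> (c x \<odot>\<^bsub>free_module R X\<^esub> unit_vector R x)"
        using cR by (auto simp: free_module_simps unit_vector_def fun_eq_iff)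
      then have "h c = h (?d \<oplus>\<^bsub>free_module R X\<^esub> (c x \<odot>\<^bsub>free_module R X\<^esub> unit_vector R x))"
        by (rule arg_cong)
      also have "\<dots> = h ?d \<oplus>\<^bsub>N\<^esub> h (c x \<odot>\<^bsub>free_module R X\<^esub> unit_vector R x)"
        by (rule linear_mapsD(2)[OF h d F.smult_closed[OF cR e]])
      also have "h (c x \<odot>\<^bsub>free_module R X\<^esub> unit_vector R x) = c x \<odot>\<^bsub>N\<^esub> h (unit_vector R x)"
        by (rule linear_mapsD(3)[OF h cR e])
      finally show ?thesis .
    qed
    show ?case
      unfolding split[OF f] split[OF g] insert.hyps(3)[OF S d] eq[OF x] ..
  qed
qed

text \<open>
  The types of \<open>A\<close> and \<open>B\<close> are arbitrary here, unlike in \<open>projective_module\<close>. Requiring only that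
  the image of \<open>f\<close> lies in the image of \<open>g\<close>, instead of surjectivity of \<open>g\<close>, lets later proofs lift
  into kernels without treating them as modules.
\<close>
lemma free_module_lift:
  assumes A: "Module.module R A" and B: "Module.module R B"
    and f: "f \<in> linear_maps R (free_module R X) B" and g: "g \<in> linear_maps R A B"
    and sub: "f ` carrier (free_module R X) \<subseteq> g ` carrier A"
  shows "\<exists>h\<in>linear_maps R (free_module R X) A. \<forall>x\<in>carrier (free_module R X). g (h x) = f x"
proof -
  interpret A: Module.module R A by fact
  interpret F: Module.module R "free_module R X" by (rule module_free_module[OF A.R.is_cring])
  have unit: "unit_vector R x \<in> carrier (free_module R X)" if "x \<in> X" for x
    using that linear_extension_unit_vector(2)[OF A, of "\<lambda>_. \<zero>\<^bsub>A\<^esub>"] by auto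
  have "\<exists>a\<in>carrier A. g a = f (unit_vector R x)" if "x \<in> X" for x
    using sub unit[OF that] by (metis image_eqI image_iff subsetD)
  then obtain a where a: "\<And>x. x \<in> X \<Longrightarrow> a x \<in> carrier A \<and> g (a x) = f (unit_vector R x)"
    by metis
  then have aX: "a \<in> X \<rightarrow> carrier A" by auto
  note h = linear_extension_linear[OF A aX]
  have "g (linear_extension R A a c) = f c" if "c \<in> carrier (free_module R X)" for c
    using linear_maps_eq_if_eq_on_unit_vectors[OF B linear_maps_comp[OF h g] f _ that] a
      linear_extension_unit_vector(1)[OF A aX] by auto
  then show ?thesis using h by auto
qed

lemma projective_free_module:
  fixes R :: "'a ring" and X :: "'b set"
  assumes "cring R" shows "projective_module R (free_module R X)"
  unfolding projective_module_def
proof (intro conjI allI ballI impI)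
  show "Module.module R (free_module R X)" by (rule module_free_module[OF assms])
next
  fix A :: "('a, ('b \<Rightarrow> 'a) \<Rightarrow> 'a) module" and B :: "('a, 'b \<Rightarrow> 'a) module" and f g
  assume "g \<in> linear_maps R A B" "f \<in> linear_maps R (free_module R X) B"
    "Module.module R A" "Module.module R B" "g ` carrier A = carrier B"
  then show "\<exists>h\<in>linear_maps R (free_module R X) A.
      \<forall>x\<in>carrier (free_module R X). g (h x) = f x"
    using linear_mapsD(1)[of f R "free_module R X" B] by (intro free_module_lift) auto
qed

text \<open>
  The definition of \<open>projective_module\<close> admits just enough types to split the canonical surjection
  onto \<open>P\<close> from the free module on its elements; lifting along maps between arbitrary types is then
  inherited from that free module.
\<close>
lemma projective_module_lift:
  assumes P: "projective_module R P"
    and A: "Module.module R A" and B: "Module.module R B"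
    and f: "f \<in> linear_maps R P B" and g: "g \<in> linear_maps R A B"
    and sub: "f ` carrier P \<subseteq> g ` carrier A"
  shows "\<exists>h\<in>linear_maps R P A. \<forall>x\<in>carrier P. g (h x) = f x"
proof -
  have PM: "Module.module R P" using P by (simp add: projective_module_def)
  interpret P: Module.module R P by fact
  let ?F = "free_module R (carrier P)"
  let ?p = "linear_extension R P (\<lambda>x. x)"
  have F: "Module.module R ?F" by (rule module_free_module[OF P.R.is_cring])
  have p: "?p \<in> linear_maps R ?F P" by (rule linear_extension_linear[OF PM]) simp
  have "?p ` carrier ?F = carrier P"
  proof
    show "?p ` carrier ?F \<subseteq> carrier P" using linear_mapsD(1)[OF p] by blast
    show "carrier P \<subseteq> ?p ` carrier ?F"
    proof
      fix x assume x: "x \<in> carrier P"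
      show "x \<in> ?p ` carrier ?F"
        using linear_extension_unit_vector[OF PM _ x, of "\<lambda>x. x"] by (intro image_eqI) simp_all
    qed
  qed
  moreover have "(\<lambda>x. x) \<in> linear_maps R P P" by (rule linear_mapsI) auto
  ultimately have "\<exists>s\<in>linear_maps R P ?F. \<forall>x\<in>carrier P. ?p (s x) = x"
    using P[unfolded projective_module_def, THEN conjunct2, rule_format, OF p _ F PM] by simp
  then obtain s where s: "s \<in> linear_maps R P ?F" "\<forall>x\<in>carrier P. ?p (s x) = x"
    by blast
  have fp: "(\<lambda>c. f (?p c)) \<in> linear_maps R ?F B" by (rule linear_maps_comp[OF p f])
  have "(\<lambda>c. f (?p c)) ` carrier ?F \<subseteq> g ` carrier A"
    using sub linear_mapsD(1)[OF p] by blast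
  then obtain h where h: "h \<in> linear_maps R ?F A" "\<forall>c\<in>carrier ?F. g (h c) = f (?p c)"
    using free_module_lift[OF A B fp g] by auto
  show ?thesis
    by (rule bexI[OF _ linear_maps_comp[OF s(1) h(1)]])
      (use h(2) s linear_mapsD(1)[OF s(1)] in auto)
qed

section \<open>Splittings from short projective resolutions\<close>

text \<open>
  The infimum in the definition of the projective dimension is attained, because \<open>enat\<close> is well-ordered.
\<close>
lemma projective_dimension_le_iff:
  "projective_dimension R (M :: ('r, 'm) module) \<le> enat d \<longleftrightarrow>
    (\<exists>(P :: nat \<Rightarrow> ('r, 'm \<times> nat \<Rightarrow> 'r) module) \<delta> \<epsilon>.
      projective_resolution R M P \<delta> \<epsilon> \<and> (\<forall>i>d. carrier (P i) = {\<zero>\<^bsub>P i\<^esub>}))"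
  (is "?l \<longleftrightarrow> ?Q d")
proof -
  define D where "D = {enat d | d. ?Q d}"
  have D: "enat e \<in> D \<longleftrightarrow> ?Q e" for e unfolding D_def by simp
  have pd: "projective_dimension R M = Inf D"
    unfolding projective_dimension_def D_def ..
  show ?thesis
  proof
    assume "?Q d"
    then show ?l unfolding pd by (intro Inf_lower) (simp only: D)
  next
    assume le: ?l
    then have "D \<noteq> {}" unfolding pd by (auto simp: Inf_enat_def)
    then have "Inf D \<in> D"
      unfolding Inf_enat_def by (auto intro: LeastI)
    moreover obtain e where e: "Inf D = enat e" "e \<le> d"
      using le unfolding pd by (cases "Inf D") auto
    ultimately have "?Q e" using D[of e] by (simp only:)
    then show "?Q d" using e(2) by (meson le_less_trans)
  qed
qed

text \<open>
  The kernel \<open>K\<close> of a surjection \<open>q : F \<rightarrow> M\<close> with \<open>F\<close> projective is itself projective when \<open>M\<close> has a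
  resolution \<open>0 \<rightarrow> P\<^sub>1 \<rightarrow> P\<^sub>0 \<rightarrow> M \<rightarrow> 0\<close>; this is Schanuel's lemma in the form in which it is used,
  namely that any \<open>g : A \<rightarrow> F\<close> with image \<open>K\<close> has a section over \<open>K\<close>. With comparison maps
  \<open>\<alpha> : P\<^sub>0 \<rightarrow> F\<close> and \<open>\<beta> : F \<rightarrow> P\<^sub>0\<close> over \<open>M\<close>, an element \<open>x\<close> of \<open>K\<close> is the sum of \<open>x - \<alpha> (\<beta> x)\<close>, which
  depends linearly on \<open>x \<in> F\<close>, and of \<open>\<alpha> (\<beta> x)\<close>, which factors through \<open>P\<^sub>1\<close>. Both summands lift along
  \<open>g\<close> because \<open>F\<close> and \<open>P\<^sub>1\<close> are projective.
\<close>
lemma kernel_splits_if_projective_dimension_le_1: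
  fixes R :: "'r ring" and M :: "('r, 'm) module" and A :: "('r, 'a) module"
  assumes M: "Module.module R M" and pd: "projective_dimension R M \<le> 1"
    and F: "projective_module R F"
    and q: "q \<in> linear_maps R F M" "q ` carrier F = carrier M"
    and A: "Module.module R A"
    and g: "g \<in> linear_maps R A F" "g ` carrier A = a_kernel F M q"
  shows "\<exists>\<sigma>\<in>linear_maps R (F\<lparr>carrier := a_kernel F M q\<rparr>) A. \<forall>x\<in>a_kernel F M q. g (\<sigma> x) = x"
proof -
  obtain P :: "nat \<Rightarrow> ('r, 'm \<times> nat \<Rightarrow> 'r) module" and \<delta> \<epsilon>
    where res: "projective_resolution R M P \<delta> \<epsilon>" and zero: "\<forall>i>1. carrier (P i) = {\<zero>\<^bsub>P i\<^esub>}"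
    using pd unfolding one_enat_def projective_dimension_le_iff by (elim exE conjE) (rule that)
  have proj: "\<And>i. projective_module R (P i)" and \<epsilon>: "\<epsilon> \<in> linear_maps R (P 0) M"
    and \<delta>: "\<delta> 0 \<in> linear_maps R (P 1) (P 0)" "\<delta> 1 \<in> linear_maps R (P 2) (P 1)"
    and surj: "\<epsilon> ` carrier (P 0) = carrier M"
    and ex0: "\<delta> 0 ` carrier (P 1) = a_kernel (P 0) M \<epsilon>"
    and ex1: "\<delta> 1 ` carrier (P 2) = a_kernel (P 1) (P 0) (\<delta> 0)"
    using res unfolding projective_resolution_def by (auto simp: numeral_2_eq_2)
  \<comment> \<open>keeps \<open>P 1\<close> in the form in which the preceding facts state it\<close>
  note One_nat_def [simp del]
  have mod: "\<And>i. Module.module R (P i)" and FM: "Module.module R F"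
    using proj F by (auto simp: projective_module_def)
  interpret P0: Module.module R "P 0" by (rule mod)
  interpret P1: Module.module R "P 1" by (rule mod)
  interpret F: Module.module R F by fact
  interpret M: Module.module R M by fact
  note qD = linear_mapsD[OF q(1)] and \<epsilon>D = linear_mapsD[OF \<epsilon>] and \<delta>D = linear_mapsD[OF \<delta>(1)]
    and gD = linear_mapsD[OF g(1)]
  have "a_kernel (P 1) (P 0) (\<delta> 0) = {\<zero>\<^bsub>P 1\<^esub>}"
    using ex1 zero linear_maps_zero[OF mod mod \<delta>(2)] by simp
  then have ker0: "y = \<zero>\<^bsub>P 1\<^esub>" if "y \<in> carrier (P 1)" "\<delta> 0 y = \<zero>\<^bsub>P 0\<^esub>" for y
    using that by (auto simp: a_kernel_def')
  have inj: "inj_on (\<delta> 0) (carrier (P 1))"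
    using ker0 by (rule linear_maps_inj_on[OF mod mod \<delta>(1)])
  obtain \<alpha> where \<alpha>: "\<alpha> \<in> linear_maps R (P 0) F" "\<forall>x\<in>carrier (P 0). q (\<alpha> x) = \<epsilon> x"
    using projective_module_lift[OF proj FM M \<epsilon> q(1)] q(2) surj by auto
  obtain \<beta> where \<beta>: "\<beta> \<in> linear_maps R F (P 0)" "\<forall>x\<in>carrier F. \<epsilon> (\<beta> x) = q x"
    using projective_module_lift[OF F mod M q(1) \<epsilon>] q(2) surj by auto
  note \<alpha>D = linear_mapsD[OF \<alpha>(1)] and \<beta>D = linear_mapsD[OF \<beta>(1)]
  have \<alpha>\<delta>: "(\<lambda>x. \<alpha> (\<delta> 0 x)) \<in> linear_maps R (P 1) F"
    by (rule linear_maps_comp[OF \<delta>(1) \<alpha>(1)])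
  have \<delta>ker: "\<delta> 0 y \<in> carrier (P 0) \<and> \<epsilon> (\<delta> 0 y) = \<zero>\<^bsub>M\<^esub>" if "y \<in> carrier (P 1)" for y
    using ex0 that by (auto simp: a_kernel_def')
  have "(\<lambda>x. \<alpha> (\<delta> 0 x)) ` carrier (P 1) \<subseteq> g ` carrier A"
    using \<alpha> \<alpha>D(1) \<delta>ker by (auto simp: g(2) a_kernel_def')
  then obtain \<nu> where \<nu>: "\<nu> \<in> linear_maps R (P 1) A" "\<forall>x\<in>carrier (P 1). g (\<nu> x) = \<alpha> (\<delta> 0 x)"
    using projective_module_lift[OF proj A FM \<alpha>\<delta> g(1)] by auto
  note \<nu>D = linear_mapsD[OF \<nu>(1)]
  let ?\<theta> = "\<lambda>x. x \<ominus>\<^bsub>F\<^esub> \<alpha> (\<beta> x)"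
  have \<theta>: "?\<theta> \<in> linear_maps R F F"
  proof (rule linear_mapsI)
    show "?\<theta> (x \<oplus>\<^bsub>F\<^esub> y) = ?\<theta> x \<oplus>\<^bsub>F\<^esub> ?\<theta> y" if "x \<in> carrier F" "y \<in> carrier F" for x y
      using that by (simp add: \<alpha>D \<beta>D a_minus_def F.minus_add F.a_ac)
    show "?\<theta> (a \<odot>\<^bsub>F\<^esub> x) = a \<odot>\<^bsub>F\<^esub> ?\<theta> x" if "a \<in> carrier R" "x \<in> carrier F" for a x
      using that by (simp add: \<alpha>D \<beta>D a_minus_def F.smult_r_distr F.smult_r_minus)
  qed (simp add: \<alpha>D \<beta>D)
  have "q (?\<theta> x) = \<zero>\<^bsub>M\<^esub>" if "x \<in> carrier F" for x
    using that linear_maps_minus[OF FM M q(1)] \<alpha> \<beta> \<alpha>D(1) \<beta>D(1) qD(1)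
    by (simp add: a_minus_def M.r_neg)
  then have "?\<theta> ` carrier F \<subseteq> g ` carrier A"
    using linear_mapsD(1)[OF \<theta>] by (auto simp: g(2) a_kernel_def')
  then obtain \<mu> where \<mu>: "\<mu> \<in> linear_maps R F A" "\<forall>x\<in>carrier F. g (\<mu> x) = ?\<theta> x"
    using projective_module_lift[OF F A FM \<theta> g(1)] by auto
  note \<mu>D = linear_mapsD[OF \<mu>(1)]
  interpret A: Module.module R A by fact
  let ?K = "a_kernel F M q"
  \<comment> \<open>On the kernel, \<open>\<beta>\<close> has its values in the image of \<open>\<delta> 0\<close>, so \<open>\<alpha> (\<beta> x)\<close> is the value at \<open>y x\<close> of a map on \<open>P 1\<close>.\<close>
  define y where "y x = the_inv_into (carrier (P 1)) (\<delta> 0) (\<beta> x)" for x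
  have K: "x \<in> carrier F" "q x = \<zero>\<^bsub>M\<^esub>" if "x \<in> ?K" for x
    using that by (auto simp: a_kernel_def')
  have y: "y x \<in> carrier (P 1)" "\<delta> 0 (y x) = \<beta> x" if "x \<in> ?K" for x
  proof -
    have "\<beta> x \<in> \<delta> 0 ` carrier (P 1)"
      unfolding ex0 using K[OF that] \<beta> \<beta>D(1) by (simp add: a_kernel_def')
    then show "y x \<in> carrier (P 1)" "\<delta> 0 (y x) = \<beta> x"
      unfolding y_def
      by (rule the_inv_into_into[OF inj _ order_refl], rule f_the_inv_into_f[OF inj])
  qed
  have yI: "y x = z" if "x \<in> ?K" "z \<in> carrier (P 1)" "\<delta> 0 z = \<beta> x" for x z
    using inj y[OF that(1)] that by (simp add: inj_on_def)
  let ?\<sigma> = "\<lambda>x. \<mu> x \<oplus>\<^bsub>A\<^esub> \<nu> (y x)"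
  have \<sigma>: "?\<sigma> \<in> linear_maps R (F\<lparr>carrier := ?K\<rparr>) A"
  proof (rule linear_mapsI; simp)
    fix x assume x: "x \<in> ?K"
    show "?\<sigma> x \<in> carrier A"
      using y[OF x] K[OF x] by (simp add: \<mu>D \<nu>D)
    {
      fix x' assume x': "x' \<in> ?K"
      have "x \<oplus>\<^bsub>F\<^esub> x' \<in> ?K"
        using K[OF x] K[OF x'] by (simp add: a_kernel_def' qD)
      then have "y (x \<oplus>\<^bsub>F\<^esub> x') = y x \<oplus>\<^bsub>P 1\<^esub> y x'"
        using y[OF x] y[OF x'] K[OF x] K[OF x'] by (intro yI) (simp_all add: \<delta>D \<beta>D)
      then show "\<mu> (x \<oplus>\<^bsub>F\<^esub> x') \<oplus>\<^bsub>A\<^esub> \<nu> (y (x \<oplus>\<^bsub>F\<^esub> x')) =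
          \<mu> x \<oplus>\<^bsub>A\<^esub> \<nu> (y x) \<oplus>\<^bsub>A\<^esub> (\<mu> x' \<oplus>\<^bsub>A\<^esub> \<nu> (y x'))"
        using y[OF x] y[OF x'] K[OF x] K[OF x'] by (simp add: \<mu>D \<nu>D A.a_ac)
    next
      fix a assume a: "a \<in> carrier R"
      have "a \<odot>\<^bsub>F\<^esub> x \<in> ?K"
        using K[OF x] a by (simp add: a_kernel_def' qD)
      then have "y (a \<odot>\<^bsub>F\<^esub> x) = a \<odot>\<^bsub>P 1\<^esub> y x"
        using y[OF x] K[OF x] a by (intro yI) (simp_all add: \<delta>D \<beta>D)
      then show "\<mu> (a \<odot>\<^bsub>F\<^esub> x) \<oplus>\<^bsub>A\<^esub> \<nu> (y (a \<odot>\<^bsub>F\<^esub> x)) = a \<odot>\<^bsub>A\<^esub> (\<mu> x \<oplus>\<^bsub>A\<^esub> \<nu> (y x))"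
        using y[OF x] K[OF x] a by (simp add: \<mu>D \<nu>D A.smult_r_distr)
    }
  qed
  have "g (?\<sigma> x) = x" if x: "x \<in> ?K" for x
  proof -
    have "g (?\<sigma> x) = ?\<theta> x \<oplus>\<^bsub>F\<^esub> \<alpha> (\<beta> x)"
      using y[OF x] K[OF x] \<mu> \<nu> by (simp add: gD \<mu>D \<nu>D)
    also have "\<dots> = x"
      using K[OF x] by (simp add: a_minus_def \<alpha>D \<beta>D F.a_assoc F.l_neg)
    finally show ?thesis .
  qed
  then show ?thesis by (intro bexI[OF _ \<sigma>] ballI)
qed

text \<open>
  A resolution of length \<open>0\<close> is an isomorphism from a projective module to \<open>M\<close>.
\<close>
lemma surjection_splits_if_projective_dimension_0:
  fixes R :: "'r ring" and M :: "('r, 'm) module"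
  assumes M: "Module.module R M" and pd: "projective_dimension R M = 0"
    and A: "Module.module R A"
    and g: "g \<in> linear_maps R A M" "g ` carrier A = carrier M"
  shows "\<exists>\<sigma>\<in>linear_maps R M A. \<forall>x\<in>carrier M. g (\<sigma> x) = x"
proof -
  obtain P :: "nat \<Rightarrow> ('r, 'm \<times> nat \<Rightarrow> 'r) module" and \<delta> \<epsilon>
    where res: "projective_resolution R M P \<delta> \<epsilon>" and zero: "\<forall>i>0. carrier (P i) = {\<zero>\<^bsub>P i\<^esub>}"
    using eq_refl[OF pd] unfolding zero_enat_def projective_dimension_le_iff
    by (elim exE conjE) (rule that)
  have proj: "\<And>i. projective_module R (P i)" and \<epsilon>: "\<epsilon> \<in> linear_maps R (P 0) M"
    and \<delta>: "\<delta> 0 \<in> linear_maps R (P 1) (P 0)"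
    and surj: "\<epsilon> ` carrier (P 0) = carrier M"
    and ex0: "\<delta> 0 ` carrier (P 1) = a_kernel (P 0) M \<epsilon>"
    using res unfolding projective_resolution_def by auto
  have mod: "\<And>i. Module.module R (P i)"
    using proj by (auto simp: projective_module_def)
  interpret P0: Module.module R "P 0" by (rule mod)
  interpret M: Module.module R M by fact
  have "a_kernel (P 0) M \<epsilon> = {\<zero>\<^bsub>P 0\<^esub>}"
    using ex0 zero linear_maps_zero[OF mod mod \<delta>] by simp
  then have ker: "y = \<zero>\<^bsub>P 0\<^esub>" if "y \<in> carrier (P 0)" "\<epsilon> y = \<zero>\<^bsub>M\<^esub>" for y
    using that by (auto simp: a_kernel_def')
  obtain h where h: "h \<in> linear_maps R (P 0) A" "\<forall>x\<in>carrier (P 0). g (h x) = \<epsilon> x"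
    using projective_module_lift[OF proj A M \<epsilon> g(1)] g(2) surj by auto
  have inj: "inj_on \<epsilon> (carrier (P 0))"
    using ker by (rule linear_maps_inj_on[OF mod M \<epsilon>])
  define y where "y = the_inv_into (carrier (P 0)) \<epsilon>"
  have y: "y x \<in> carrier (P 0)" "\<epsilon> (y x) = x" if "x \<in> carrier M" for x
    unfolding y_def using that surj
    by (simp_all add: the_inv_into_into[OF inj _ order_refl] f_the_inv_into_f[OF inj])
  have yI: "y x = z" if "x \<in> carrier M" "z \<in> carrier (P 0)" "\<epsilon> z = x" for x z
    using inj y[OF that(1)] that by (simp add: inj_on_def)
  have ylin: "y \<in> linear_maps R M (P 0)"
    by (rule linear_mapsI) (auto intro!: yI simp: y linear_mapsD[OF \<epsilon>])
  then show ?thesis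
    using h(2) y by (intro bexI[OF _ linear_maps_comp[OF ylin h(1)]]) simp
qed

section \<open>Divisibility of monomials\<close>

definition divides :: "('x \<Rightarrow>\<^sub>0 nat) \<Rightarrow> ('x \<Rightarrow>\<^sub>0 nat) \<Rightarrow> bool"  (infix "\<preceq>" 50) where
  "s \<preceq> t \<longleftrightarrow> (\<forall>x. Poly_Mapping.lookup s x \<le> Poly_Mapping.lookup t x)"

lemma divides_refl [simp]: "s \<preceq> s"
  by (simp add: divides_def)

lemma divides_trans: "r \<preceq> s \<Longrightarrow> s \<preceq> t \<Longrightarrow> r \<preceq> t"
  unfolding divides_def using order_trans by blast

lemma divides_add [simp]: "s \<preceq> s + t" "s \<preceq> t + s"
  by (simp_all add: divides_def lookup_add)

lemma divides_diff_add: "s \<preceq> t \<Longrightarrow> t - s + s = t"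
  by (rule poly_mapping_eqI) (simp add: divides_def lookup_add lookup_minus)

lemma divides_iff_ex_add: "s \<preceq> t \<longleftrightarrow> (\<exists>d. t = s + d)"
proof
  assume "s \<preceq> t"
  then have "t = s + (t - s)" using divides_diff_add[of s t] by (simp add: add.commute)
  then show "\<exists>d. t = s + d" ..
qed auto

lemma divides_diff_iff: "t \<preceq> m \<Longrightarrow> m - t \<preceq> s \<longleftrightarrow> m \<preceq> s + t"
  unfolding divides_def by (simp add: lookup_minus lookup_add le_diff_conv)

lemma lookup_exponent_max:
  "Poly_Mapping.lookup (exponent_max s t) x = max (Poly_Mapping.lookup s x) (Poly_Mapping.lookup t x)"
  by transfer simp

lemma exponent_max_divides_iff: "exponent_max s t \<preceq> m \<longleftrightarrow> s \<preceq> m \<and> t \<preceq> m"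
  by (auto simp: divides_def lookup_exponent_max)

lemma divides_exponent_max [simp]: "s \<preceq> exponent_max s t" "t \<preceq> exponent_max s t"
  by (simp_all add: divides_def lookup_exponent_max)

lemma lookup_monomial_mult:
  fixes p :: "('x::finite, 'k::field) polynomial"
  shows "Poly_Mapping.lookup (p * monomial t) m =
    (if t \<preceq> m then Poly_Mapping.lookup p (m - t) else 0)"
proof -
  have "Poly_Mapping.lookup (p * monomial t) m = Poly_Mapping.lookup (monomial t * p) m"
    by (simp add: mult.commute)
  also have "\<dots> = (\<Sum>q. Poly_Mapping.lookup p q when m = t + q)"
    unfolding monomial_def by (simp add: lookup_mult lookup_single when_mult)
  also have "\<dots> = (if t \<preceq> m then Poly_Mapping.lookup p (m - t) else 0)"
  proof (cases "t \<preceq> m")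
    case True
    then have "m = t + q \<longleftrightarrow> q = m - t" for q
      using divides_diff_add[OF True] by (auto simp: add.commute)
    then show ?thesis using True by simp
  next
    case False
    then have "m \<noteq> t + q" for q by (auto simp: divides_iff_ex_add)
    then show ?thesis using False by simp
  qed
  finally show ?thesis .
qed

lemma monomial_mult: "monomial s * monomial t = (monomial (s + t) :: ('x::finite, 'k::field) polynomial)"
  by (simp add: monomial_def mult_single)

lemma lookup_monomial: "Poly_Mapping.lookup (monomial t :: ('x::finite, 'k::field) polynomial) m = (if m = t then 1 else 0)"
  by (simp add: monomial_def lookup_single when_def)

lemma monomial_dvd_iff:
  "(monomial s :: ('x::finite, 'k::field) polynomial) dvd monomial t \<longleftrightarrow> s \<preceq> t"
proof
  assume "(monomial s :: ('x, 'k) polynomial) dvd monomial t"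
  then obtain p :: "('x, 'k) polynomial" where p: "monomial t = p * monomial s"
    by (metis dvd_def mult.commute)
  then have "Poly_Mapping.lookup (p * monomial s) t = 1"
    by (metis lookup_monomial)
  then show "s \<preceq> t" by (auto simp: lookup_monomial_mult split: if_splits)
next
  assume "s \<preceq> t"
  then show "(monomial s :: ('x, 'k) polynomial) dvd monomial t"
    using dvd_triv_right[of "monomial s :: ('x, 'k) polynomial" "monomial (t - s)"]
    by (simp add: monomial_mult divides_diff_add)
qed

lemma monomial_mult_eq_0:
  fixes p :: "('x::finite, 'k::field) polynomial"
  assumes "p * monomial t = 0" shows "p = 0"
proof (rule poly_mapping_eqI)
  fix s
  have "Poly_Mapping.lookup (p * monomial t) (s + t) = Poly_Mapping.lookup p s"
    by (simp add: lookup_monomial_mult)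
  then show "Poly_Mapping.lookup p s = Poly_Mapping.lookup 0 s"
    using assms by simp
qed

definition total_degree :: "('x::finite \<Rightarrow>\<^sub>0 nat) \<Rightarrow> nat" where
  "total_degree t = (\<Sum>x\<in>UNIV. Poly_Mapping.lookup t x)"

lemma total_degree_add: "total_degree (s + t) = total_degree s + total_degree t"
  by (simp add: total_degree_def lookup_add sum.distrib)

lemma total_degree_eq_0: "total_degree t = 0 \<longleftrightarrow> t = 0"
  by (auto simp: total_degree_def intro: poly_mapping_eqI)

section \<open>Graphs on exponents\<close>

type_synonym 'a graph = "('a \<times> 'a) set"

text \<open>
  Ordered pairs represent undirected edges: direction matters only for the sign of a syzygy, and
  \<open>linked\<close> ignores it.
\<close>
definition linked :: "'a graph \<Rightarrow> 'a graph" where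
  "linked E = (E \<union> E\<inverse>)\<^sup>*"

definition edges_below :: "('x \<Rightarrow>\<^sub>0 nat) graph \<Rightarrow> ('x \<Rightarrow>\<^sub>0 nat) \<Rightarrow> ('x \<Rightarrow>\<^sub>0 nat) graph" where
  "edges_below E m = {(a, b) \<in> E. a \<preceq> m \<and> b \<preceq> m}"

text \<open>
  The combinatorial form of generation: the edge syzygies then account for every syzygy, whatever
  the degree \<open>m\<close> in which it lives.
\<close>
definition connected_below :: "('x \<Rightarrow>\<^sub>0 nat) set \<Rightarrow> ('x \<Rightarrow>\<^sub>0 nat) graph \<Rightarrow> bool" where
  "connected_below T E \<longleftrightarrow>
    (\<forall>m. \<forall>a\<in>T. \<forall>b\<in>T. a \<preceq> m \<longrightarrow> b \<preceq> m \<longrightarrow> (a, b) \<in> linked (edges_below E m))"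

text \<open>
  Acyclicity in the form in which it is used: every edge is a bridge. In particular there are no loops
  and no edge occurs in both directions.
\<close>
definition forest :: "'a graph \<Rightarrow> bool" where
  "forest E \<longleftrightarrow> (\<forall>(a, b)\<in>E. (a, b) \<notin> linked (E - {(a, b)}))"

lemma linked_refl [simp]: "(a, a) \<in> linked E"
  by (simp add: linked_def)

lemma linked_edge: "(a, b) \<in> E \<Longrightarrow> (a, b) \<in> linked E" "(b, a) \<in> E \<Longrightarrow> (a, b) \<in> linked E"
  by (auto simp: linked_def)

lemma linked_sym: "(a, b) \<in> linked E \<Longrightarrow> (b, a) \<in> linked E"
  using sym_rtrancl[OF sym_Un_converse[of E]] unfolding linked_def sym_def by simp

lemma linked_trans: "(a, b) \<in> linked E \<Longrightarrow> (b, c) \<in> linked E \<Longrightarrow> (a, c) \<in> linked E"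
  unfolding linked_def by (rule rtrancl_trans)

lemma linked_mono:
  assumes "E \<subseteq> linked F" shows "linked E \<subseteq> linked F"
proof -
  have "E \<union> E\<inverse> \<subseteq> linked F" using assms by (auto intro: linked_sym)
  then have "(E \<union> E\<inverse>)\<^sup>* \<subseteq> ((F \<union> F\<inverse>)\<^sup>*)\<^sup>*"
    unfolding linked_def by (rule rtrancl_mono)
  then show ?thesis by (simp add: linked_def)
qed

lemma linked_subset: "E \<subseteq> F \<Longrightarrow> linked E \<subseteq> linked F"
  by (rule linked_mono) (auto intro: linked_edge)

lemma linked_crossing_edge:
  assumes "(a, b) \<in> linked E" "a \<in> V" "b \<notin> V"
  obtains x y where "(x, y) \<in> E \<or> (y, x) \<in> E" "x \<in> V" "y \<notin> V"
proof -
  have "b \<in> V \<or> (\<exists>x y. ((x, y) \<in> E \<or> (y, x) \<in> E) \<and> x \<in> V \<and> y \<notin> V)"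
    using assms(1) unfolding linked_def
    by (induction rule: rtrancl_induct) (use assms(2) in auto)
  then show ?thesis using assms(3) that by blast
qed

section \<open>Syzygies of pairs\<close>

text \<open>
  With a common multiple \<open>m\<close> of \<open>a\<close> and \<open>b\<close> as a parameter, these syzygies telescope along paths
  whose vertices divide \<open>m\<close>.
\<close>
definition pair_syzygy ::
  "('x::finite \<Rightarrow>\<^sub>0 nat) \<Rightarrow> ('x \<Rightarrow>\<^sub>0 nat) \<Rightarrow> ('x \<Rightarrow>\<^sub>0 nat) \<Rightarrow> ('x \<Rightarrow>\<^sub>0 nat) \<Rightarrow> ('x, 'k::field) polynomial" where
  "pair_syzygy m a b t =
    (if t = a then monomial (m - a) else 0) - (if t = b then monomial (m - b) else 0)"

definition edge_syzygy ::
  "('x::finite \<Rightarrow>\<^sub>0 nat) \<times> ('x \<Rightarrow>\<^sub>0 nat) \<Rightarrow> ('x \<Rightarrow>\<^sub>0 nat) \<Rightarrow> ('x, 'k::field) polynomial" where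
  "edge_syzygy e = pair_syzygy (exponent_max (fst e) (snd e)) (fst e) (snd e)"

definition edge_span ::
  "('x::finite \<Rightarrow>\<^sub>0 nat) graph \<Rightarrow> (('x \<Rightarrow>\<^sub>0 nat) \<Rightarrow> ('x, 'k::field) polynomial) set" where
  "edge_span E = {f. \<exists>c. f = (\<lambda>t. \<Sum>e\<in>E. c e * edge_syzygy e t)}"

lemma pair_syzygy_eq_mult_edge_syzygy:
  assumes "a \<preceq> m" "b \<preceq> m"
  shows "pair_syzygy m a b t =
    (monomial (m - exponent_max a b) * edge_syzygy (a, b) t :: ('x::finite, 'k::field) polynomial)"
proof -
  let ?l = "exponent_max a b"
  have l: "?l \<preceq> m" using assms by (simp add: exponent_max_divides_iff)
  have shift: "m - ?l + (?l - c) = m - c" if "c \<preceq> ?l" for c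
    using l that divides_trans[OF that l] 
    by (intro poly_mapping_eqI) (simp add: lookup_minus lookup_add divides_def)
  show ?thesis
    using shift[of a] shift[of b]
    by (auto simp: edge_syzygy_def pair_syzygy_def right_diff_distrib monomial_mult)
qed

lemma sum_pair_syzygy:
  assumes "finite T" "a \<preceq> m" "b \<preceq> m"
  shows "(\<Sum>t\<in>T. pair_syzygy m a b t * monomial t :: ('x::finite, 'k::field) polynomial) =
    (if a \<in> T then monomial m else 0) - (if b \<in> T then monomial m else 0)"
proof -
  have "(\<Sum>t\<in>T. pair_syzygy m a b t * monomial t :: ('x, 'k) polynomial) =
      (\<Sum>t\<in>T. if t = a then monomial m else 0) - (\<Sum>t\<in>T. if t = b then monomial m else 0)"
    unfolding sum_subtractf[symmetric]
    using assms by (intro sum.cong) (auto simp: pair_syzygy_def left_diff_distrib monomial_mult divides_diff_add)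
  then show ?thesis using assms(1) by simp
qed

lemma edge_spanI: "(\<And>t. f t = (\<Sum>e\<in>E. c e * edge_syzygy e t)) \<Longrightarrow> f \<in> edge_span E"
  unfolding edge_span_def by blast

lemma edge_span_add:
  assumes "f \<in> edge_span E" "g \<in> edge_span E"
  shows "(\<lambda>t. f t + g t) \<in> edge_span E"
proof -
  obtain c d where "f = (\<lambda>t. \<Sum>e\<in>E. c e * edge_syzygy e t)" "g = (\<lambda>t. \<Sum>e\<in>E. d e * edge_syzygy e t)"
    using assms by (auto simp: edge_span_def)
  then show ?thesis
    by (intro edge_spanI[of _ "\<lambda>e. c e + d e"]) (simp add: sum.distrib distrib_right)
qed

lemma edge_span_mult:
  assumes "f \<in> edge_span E" shows "(\<lambda>t. p * f t) \<in> edge_span E"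
proof -
  obtain c where "f = (\<lambda>t. \<Sum>e\<in>E. c e * edge_syzygy e t)"
    using assms by (auto simp: edge_span_def)
  then show ?thesis
    by (intro edge_spanI[of _ "\<lambda>e. p * c e"]) (simp add: sum_distrib_left mult.assoc)
qed

lemma edge_span_zero: "(\<lambda>_. 0) \<in> edge_span E"
  by (rule edge_spanI[of _ "\<lambda>_. 0"]) simp

lemma edge_syzygy_in_edge_span:
  assumes "finite E" "e \<in> E" shows "edge_syzygy e \<in> edge_span E"
  using assms
  by (intro edge_spanI[of _ "\<lambda>e'. if e' = e then 1 else 0"])
    (simp add: if_distrib[of "\<lambda>x. x * _"] cong: if_cong)

lemma pair_syzygy_in_edge_span:
  assumes "finite E" "(a, b) \<in> linked (edges_below E m)"
  shows "(pair_syzygy m a b :: _ \<Rightarrow> ('x::finite, 'k::field) polynomial) \<in> edge_span E"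
  using assms(2) unfolding linked_def
proof (induction rule: rtrancl_induct)
  case base
  have "pair_syzygy m a a = (\<lambda>_. 0 :: ('x, 'k) polynomial)" by (auto simp: pair_syzygy_def)
  then show ?case by (simp add: edge_span_zero)
next
  case (step b c)
  have in_span: "(pair_syzygy m x y :: _ \<Rightarrow> ('x, 'k) polynomial) \<in> edge_span E" if "(x, y) \<in> edges_below E m" for x y
  proof -
    have "(\<lambda>t. monomial (m - exponent_max x y) * edge_syzygy (x, y) t :: ('x, 'k) polynomial) \<in> edge_span E"
      using that assms(1) by (intro edge_span_mult edge_syzygy_in_edge_span) (auto simp: edges_below_def)
    moreover have "(\<lambda>t. monomial (m - exponent_max x y) * edge_syzygy (x, y) t :: ('x, 'k) polynomial) = pair_syzygy m x y"
      using that by (auto simp: edges_below_def pair_syzygy_eq_mult_edge_syzygy)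
    ultimately show ?thesis by simp
  qed
  have "(pair_syzygy m b c :: _ \<Rightarrow> ('x, 'k) polynomial) \<in> edge_span E"
    using step.hyps(2)
  proof
    assume "(b, c) \<in> (edges_below E m)\<inverse>"
    then have "(\<lambda>t. - 1 * pair_syzygy m c b t :: ('x, 'k) polynomial) \<in> edge_span E"
      using in_span by (intro edge_span_mult) auto
    moreover have "(\<lambda>t. - 1 * pair_syzygy m c b t :: ('x, 'k) polynomial) = pair_syzygy m b c"
      by (auto simp: pair_syzygy_def)
    ultimately show ?thesis by simp
  qed (rule in_span)
  then have "(\<lambda>t. pair_syzygy m a b t + pair_syzygy m b c t :: ('x, 'k) polynomial) \<in> edge_span E"
    using step.IH by (intro edge_span_add)
  moreover have "(\<lambda>t. pair_syzygy m a b t + pair_syzygy m b c t :: ('x, 'k) polynomial) = pair_syzygy m a c"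
    by (auto simp: pair_syzygy_def)
  ultimately show ?case by simp
qed

text \<open>
  A term of a syzygy \<open>f\<close> in coordinate \<open>t\<close> contributes a monomial \<open>m\<close> to the sum, which another
  coordinate \<open>s\<close> must cancel. Subtracting the matching multiple of the pair syzygy of \<open>t\<close> and \<open>s\<close>
  removes that term and creates none elsewhere, so the number of terms drops. As \<open>t\<close> and \<open>s\<close> both
  divide \<open>m\<close>, a path in the graph expresses that pair syzygy by edge syzygies.
\<close>
lemma syzygy_in_edge_span:
  fixes f :: "('x::finite \<Rightarrow>\<^sub>0 nat) \<Rightarrow> ('x, 'k::field) polynomial"
  assumes "finite T" "finite E" "connected_below T E"
    and "\<And>t. t \<notin> T \<Longrightarrow> f t = 0" "(\<Sum>t\<in>T. f t * monomial t) = 0"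
  shows "f \<in> edge_span E"
  using assms(4,5)
proof (induction "\<Sum>t\<in>T. card (Poly_Mapping.keys (f t))" arbitrary: f rule: less_induct)
  case less
  show ?case
  proof (cases "\<exists>t\<in>T. f t \<noteq> 0")
    case False
    then have "f = (\<lambda>_. 0)" using less.prems(1) by blast
    then show ?thesis by (simp add: edge_span_zero)
  next
    case True
    then obtain t a where t: "t \<in> T" and a: "a \<in> Poly_Mapping.keys (f t)"
      by (metis keys_eq_empty ex_in_conv)
    define m where "m = a + t"
    define c where "c = Poly_Mapping.lookup (f t) a"
    let ?F = "\<lambda>s. Poly_Mapping.lookup (f s * monomial s) m"
    have "(\<Sum>s\<in>T. ?F s) = 0"
      using arg_cong[OF less.prems(2), of "\<lambda>p. Poly_Mapping.lookup p m"] by (simp add: lookup_sum)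
    moreover have Ft: "?F t = c" by (simp add: lookup_monomial_mult m_def c_def)
    moreover have c: "c \<noteq> 0" using a by (simp add: c_def in_keys_iff)
    ultimately have "(\<Sum>s\<in>T - {t}. ?F s) \<noteq> 0"
      using sum.remove[OF assms(1) t, of ?F] by auto
    then obtain s where "s \<in> T - {t}" and Fs: "?F s \<noteq> 0"
      by (rule sum.not_neutral_contains_not_neutral)
    then have s: "s \<in> T" "s \<noteq> t" by auto
    from Fs have sm: "s \<preceq> m" and ks: "m - s \<in> Poly_Mapping.keys (f s)"
      by (auto simp: lookup_monomial_mult in_keys_iff split: if_splits)
    have tm: "t \<preceq> m" by (simp add: m_def)
    have "(pair_syzygy m t s :: _ \<Rightarrow> ('x, 'k) polynomial) \<in> edge_span E"
      using assms(3) t s(1) tm sm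
      by (intro pair_syzygy_in_edge_span[OF assms(2)]) (auto simp: connected_below_def)
    then have pair: "(\<lambda>r. Poly_Mapping.single 0 c * pair_syzygy m t s r) \<in> edge_span E"
      by (rule edge_span_mult)
    define g where "g r = f r - Poly_Mapping.single 0 c * pair_syzygy m t s r" for r
    have gt: "g t = f t - Poly_Mapping.single a c"
      using s(2) by (simp add: g_def pair_syzygy_def m_def monomial_def mult_single)
    have gs: "g s = f s + Poly_Mapping.single (m - s) c"
      using s(2) by (simp add: g_def pair_syzygy_def monomial_def mult_single)
    have g_other: "g r = f r" if "r \<noteq> t" "r \<noteq> s" for r
      using that by (simp add: g_def pair_syzygy_def)
    have "Poly_Mapping.keys (g t) \<subseteq> Poly_Mapping.keys (f t) - {a}"
      by (auto simp: gt in_keys_iff lookup_minus lookup_single c_def when_def split: if_splits)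
    then have "card (Poly_Mapping.keys (g t)) < card (Poly_Mapping.keys (f t))"
      using a by (intro psubset_card_mono) auto
    moreover have "Poly_Mapping.keys (g s) \<subseteq> Poly_Mapping.keys (f s)"
      using ks by (auto simp: gs in_keys_iff lookup_add lookup_single when_def split: if_splits)
    then have "card (Poly_Mapping.keys (g r)) \<le> card (Poly_Mapping.keys (f r))" if "r \<noteq> t" for r
      using g_other that by (cases "r = s") (auto intro: card_mono)
    ultimately have "(\<Sum>r\<in>T. card (Poly_Mapping.keys (g r))) < (\<Sum>r\<in>T. card (Poly_Mapping.keys (f r)))"
      using assms(1) t by (intro sum_strict_mono_ex1) (simp, metis less_imp_le, blast)
    moreover have "g r = 0" if "r \<notin> T" for r
      using that less.prems(1) g_other t s(1) by metis
    moreover have "(\<Sum>r\<in>T. g r * monomial r) = 0"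
    proof -
      have "(\<Sum>r\<in>T. g r * monomial r) = (\<Sum>r\<in>T. f r * monomial r) -
          Poly_Mapping.single 0 c * (\<Sum>r\<in>T. pair_syzygy m t s r * monomial r)"
        by (simp add: g_def left_diff_distrib sum_subtractf sum_distrib_left mult.assoc)
      then show ?thesis
        using sum_pair_syzygy[OF assms(1) tm sm, where 'k = 'k] t s(1) less.prems(2) by simp
    qed
    ultimately have "g \<in> edge_span E"
      by (rule less.hyps)
    then have "(\<lambda>r. g r + Poly_Mapping.single 0 c * pair_syzygy m t s r) \<in> edge_span E"
      using pair by (rule edge_span_add)
    then show ?thesis by (simp add: g_def)
  qed
qed

section \<open>Independent edge syzygies form a forest\<close>

text \<open>
  The first argument only carries the coefficient field, which the graph does not mention.
\<close>
definition edge_independent :: "'k::field itself \<Rightarrow> ('x::finite \<Rightarrow>\<^sub>0 nat) graph \<Rightarrow> bool" where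
  "edge_independent _ E \<longleftrightarrow>
    (\<forall>c :: _ \<Rightarrow> ('x, 'k::field) polynomial.
      (\<forall>t. (\<Sum>e\<in>E. c e * edge_syzygy e t) = 0) \<longrightarrow> (\<forall>e\<in>E. c e = 0))"

text \<open>
  If the ends of an edge were linked by other edges, the pair syzygy of the edge, taken over a
  monomial \<open>m\<close> that all vertices divide, would be a combination of the other edge syzygies.
\<close>
lemma forest_if_edge_independent:
  assumes "finite E" "edge_independent TYPE('k::field) E"
  shows "forest (E :: ('x::finite \<Rightarrow>\<^sub>0 nat) graph)"
  unfolding forest_def
proof (clarify)
  fix a b assume e: "(a, b) \<in> E" and path: "(a, b) \<in> linked (E - {(a, b)})"
  let ?E' = "E - {(a, b)}"
  \<comment> \<open>a monomial divisible by every vertex, so that the whole path lies below it\<close>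
  define m where "m = sum id (fst ` E) + sum id (snd ` E)"
  have le: "s \<preceq> sum id S" if "finite S" "s \<in> S" for s and S :: "('x \<Rightarrow>\<^sub>0 nat) set"
    using sum.remove[OF that, of id] by simp
  have below: "x \<preceq> m \<and> y \<preceq> m" if "(x, y) \<in> E" for x y
  proof -
    have "x \<in> fst ` E" "y \<in> snd ` E" using that by force+
    then show ?thesis
      unfolding m_def using le[of "fst ` E" x] le[of "snd ` E" y] assms(1)
      by (meson divides_add divides_trans finite_imageI)
  qed
  then have "edges_below ?E' m = ?E'" by (auto simp: edges_below_def)
  then have "(pair_syzygy m a b :: _ \<Rightarrow> ('x, 'k) polynomial) \<in> edge_span ?E'"
    using path assms(1) by (intro pair_syzygy_in_edge_span) auto
  then obtain d where d: "(pair_syzygy m a b :: _ \<Rightarrow> ('x, 'k) polynomial) = (\<lambda>t. \<Sum>e\<in>?E'. d e * edge_syzygy e t)"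
    by (auto simp: edge_span_def)
  define c where "c e = (if e = (a, b) then monomial (m - exponent_max a b) else - d e)" for e
  have "(\<Sum>e\<in>E. c e * edge_syzygy e t) = 0" for t
  proof -
    have "(\<Sum>e\<in>E. c e * edge_syzygy e t) = 
       monomial (m - exponent_max a b) * edge_syzygy (a, b) t + (\<Sum>e\<in>?E'. c e * edge_syzygy e t)"
      by (subst sum.remove[OF assms(1) e]) (simp add: c_def)
    also have "(\<Sum>e\<in>?E'. c e * edge_syzygy e t) = - (\<Sum>e\<in>?E'. d e * edge_syzygy e t)"
      unfolding sum_negf[symmetric] by (intro sum.cong) (auto simp: c_def)
    also have "monomial (m - exponent_max a b) * edge_syzygy (a, b) t = (pair_syzygy m a b t :: ('x, 'k) polynomial)"
      using below[OF e] by (simp add: pair_syzygy_eq_mult_edge_syzygy)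
    finally show ?thesis by (simp add: d)
  qed
  then have "c (a, b) = 0" using assms(2) e unfolding edge_independent_def by blast
  then have "monomial (m - exponent_max a b) = (0 :: ('x, 'k) polynomial)" by (simp add: c_def)
  then show False by (metis lookup_monomial lookup_zero zero_neq_one)
qed

section \<open>Minimal connected graphs\<close>

definition minimal_connected_below :: "('x::finite \<Rightarrow>\<^sub>0 nat) set \<Rightarrow> ('x \<Rightarrow>\<^sub>0 nat) graph \<Rightarrow> bool" where
  "minimal_connected_below T E \<longleftrightarrow> E \<subseteq> T \<times> T \<and> connected_below T E \<and>
     (\<forall>e\<in>E. \<not> connected_below T (E - {e}))"

lemma ex_minimal_connected_below:
  assumes "finite (T :: ('x::finite \<Rightarrow>\<^sub>0 nat) set)" shows "\<exists>E. minimal_connected_below T E"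
proof -
  have "connected_below T (T \<times> T)"
    unfolding connected_below_def by (auto intro!: linked_edge(1) simp: edges_below_def)
  then have "\<exists>E. E \<subseteq> T \<times> T \<and> connected_below T E" by blast
  then obtain E where E: "E \<subseteq> T \<times> T \<and> connected_below T E"
    and min: "\<And>F. F \<subseteq> T \<times> T \<and> connected_below T F \<Longrightarrow> card E \<le> card F"
    using ex_has_least_nat[of "\<lambda>E. E \<subseteq> T \<times> T \<and> connected_below T E" _ card] by metis
  have "finite E" using E assms by (meson finite_SigmaI finite_subset)
  then have "\<not> connected_below T (E - {e})" if "e \<in> E" for e
    using min[of "E - {e}"] that E card_Diff1_less[of E e] by (meson Diff_subset order_trans leD)
  then show ?thesis using E unfolding minimal_connected_below_def by blast
qed

text \<open>
  Suppose the coefficient of \<open>e = (a, b)\<close> has a nonzero constant term, and let \<open>l\<close> be the least common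
  multiple of \<open>a\<close> and \<open>b\<close>. Let \<open>C\<close> be the component of \<open>a\<close> in the graph of the other edges below \<open>l\<close>.
  Apply to the relation the functional that adds up \<open>x\<^sup>t\<close> times the coordinate \<open>t\<close> over \<open>t \<in> C\<close>,
  and compare coefficients at \<open>l\<close>: another edge below \<open>l\<close> contributes nothing since \<open>C\<close>
  contains both of its ends or neither, and an edge not below \<open>l\<close> contributes a multiple of a
  monomial that does not divide \<open>l\<close>. So \<open>b\<close> must lie in \<open>C\<close>, and then \<open>e\<close> is superfluous, against
  minimality.
\<close>
lemma relation_constant_coeff_eq_0:
  fixes c :: "_ \<Rightarrow> ('x::finite, 'k::field) polynomial"
  assumes T: "finite T" and E: "minimal_connected_below T E"
    and rel: "\<And>t. (\<Sum>e\<in>E. c e * edge_syzygy e t) = 0" and e: "e \<in> E"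
  shows "Poly_Mapping.lookup (c e) 0 = 0"
proof (rule ccontr)
  assume c: "Poly_Mapping.lookup (c e) 0 \<noteq> 0"
  have ET: "E \<subseteq> T \<times> T" and conn: "connected_below T E"
    using E by (auto simp: minimal_connected_below_def)
  have fin: "finite E" using ET T by (meson finite_SigmaI finite_subset)
  obtain a b where ab: "e = (a, b)" by (cases e)
  let ?l = "exponent_max a b" and ?E' = "E - {e}"
  define C where "C = {v. (a, v) \<in> linked (edges_below ?E' ?l)}"
  have "b \<in> C"
  proof (rule ccontr)
    assume b: "b \<notin> C"
    have a: "a \<in> C" by (simp add: C_def)
    let ?\<phi> = "\<lambda>e. \<Sum>t\<in>T \<inter> C. edge_syzygy e t * monomial t :: ('x, 'k) polynomial"
    have \<phi>: "?\<phi> (x, y) = (if x \<in> C then monomial (exponent_max x y) else 0) -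
        (if y \<in> C then monomial (exponent_max x y) else 0)" if "(x, y) \<in> E" for x y
      using that T ET by (auto simp: edge_syzygy_def sum_pair_syzygy)
    have "0 = (\<Sum>t\<in>T \<inter> C. (\<Sum>e\<in>E. c e * edge_syzygy e t) * monomial t)"
      by (simp add: rel)
    also have "\<dots> = (\<Sum>t\<in>T \<inter> C. \<Sum>e\<in>E. c e * (edge_syzygy e t * monomial t))"
      by (simp add: sum_distrib_right mult.assoc)
    also have "\<dots> = (\<Sum>e\<in>E. c e * ?\<phi> e)"
      unfolding sum_distrib_left by (rule sum.swap)
    finally have "Poly_Mapping.lookup 0 ?l = Poly_Mapping.lookup (\<Sum>e\<in>E. c e * ?\<phi> e) ?l"
      by (rule arg_cong)
    then have "0 = (\<Sum>e\<in>E. Poly_Mapping.lookup (c e * ?\<phi> e) ?l)"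
      by (simp only: lookup_sum lookup_zero)
    also have "\<dots> = Poly_Mapping.lookup (c e * ?\<phi> e) ?l +
        (\<Sum>e\<in>?E'. Poly_Mapping.lookup (c e * ?\<phi> e) ?l)"
      by (rule sum.remove[OF fin e])
    also have "(\<Sum>e\<in>?E'. Poly_Mapping.lookup (c e * ?\<phi> e) ?l) = 0"
    proof (rule sum.neutral, rule ballI)
      fix e' assume e': "e' \<in> ?E'"
      obtain x y where e'_eq: "e' = (x, y)" by (cases e')
      then have xy: "(x, y) \<in> E" "(x, y) \<noteq> e" using e' by auto
      show "Poly_Mapping.lookup (c e' * ?\<phi> e') ?l = 0"
      proof (cases "x \<preceq> ?l \<and> y \<preceq> ?l")
        case True
        then have "(x, y) \<in> edges_below ?E' ?l" using xy by (auto simp: edges_below_def)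
        then have "x \<in> C \<longleftrightarrow> y \<in> C"
          unfolding C_def by (auto intro: linked_trans linked_edge)
        then show ?thesis unfolding e'_eq using \<phi>[OF xy(1)] by simp
      next
        case False
        then have "\<not> exponent_max x y \<preceq> ?l" by (simp add: exponent_max_divides_iff)
        then show ?thesis
          unfolding e'_eq \<phi>[OF xy(1)] by (simp add: lookup_monomial_mult right_diff_distrib lookup_minus)
      qed
    qed
    also have "?\<phi> e = monomial ?l"
      using \<phi>[of a b] e ab a b by simp
    also have "Poly_Mapping.lookup (c e * monomial ?l) ?l + 0 = Poly_Mapping.lookup (c e) 0"
      by (simp add: lookup_monomial_mult)
    finally show False using c by simp
  qed
  then have link: "(a, b) \<in> linked (edges_below ?E' ?l)" by (simp add: C_def)
  have "linked (edges_below E m) \<subseteq> linked (edges_below ?E' m)" for m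
  proof (rule linked_mono, clarify)
    fix x y assume xy: "(x, y) \<in> edges_below E m"
    show "(x, y) \<in> linked (edges_below ?E' m)"
    proof (cases "(x, y) = e")
      case True
      then have "?l \<preceq> m" using xy ab by (auto simp: edges_below_def exponent_max_divides_iff)
      then have "edges_below ?E' ?l \<subseteq> edges_below ?E' m"
        using divides_trans by (auto simp: edges_below_def)
      then show ?thesis using link linked_subset True ab by blast
    qed (use xy in \<open>auto simp: edges_below_def intro: linked_edge\<close>)
  qed
  then have "connected_below T ?E'"
    using conn unfolding connected_below_def by blast
  then show False using E e unfolding minimal_connected_below_def by blast
qed

text \<open>
  A term of least total degree in \<open>l\<close> would arise from a term of smaller degree.
\<close>
lemma eq_0_if_fixed_by_positive_degree_matrix:
  fixes l :: "'e \<Rightarrow> ('x::finite, 'k::field) polynomial"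
  assumes fin: "finite E" and fixed: "\<And>e'. e' \<in> E \<Longrightarrow> l e' = (\<Sum>e\<in>E. l e * n e e')"
    and n: "\<And>e e'. e \<in> E \<Longrightarrow> e' \<in> E \<Longrightarrow> Poly_Mapping.lookup (n e e') 0 = 0"
    and "e \<in> E"
  shows "l e = 0"
proof -
  have "Poly_Mapping.lookup (l e) t = 0" if "e \<in> E" for t e
    using that
  proof (induction "total_degree t" arbitrary: t e rule: less_induct)
    case less
    show ?case
    proof (rule ccontr)
      assume "Poly_Mapping.lookup (l e) t \<noteq> 0"
      then have "(\<Sum>e'\<in>E. Poly_Mapping.lookup (l e' * n e' e) t) \<noteq> 0"
        by (subst (asm) fixed[OF less.prems]) (simp only: lookup_sum not_False_eq_True)
      then obtain e' where e': "e' \<in> E" "t \<in> Poly_Mapping.keys (l e' * n e' e)"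
        unfolding in_keys_iff by (rule sum.not_neutral_contains_not_neutral)
      then obtain a b where ab: "t = a + b" "a \<in> Poly_Mapping.keys (l e')" "b \<in> Poly_Mapping.keys (n e' e)"
        using keys_mult by blast
      have "b \<noteq> 0" using ab(3) n[OF e'(1) less.prems] by (auto simp: in_keys_iff)
      then have "total_degree a < total_degree t"
        using total_degree_eq_0[of b] by (simp add: ab(1) total_degree_add)
      then show False using less.hyps e'(1) ab(2) by (auto simp: in_keys_iff)
    qed
  qed
  then show ?thesis using assms(4) by (intro poly_mapping_eqI) simp
qed

text \<open>
  The rows of \<open>w\<close> are the values of a section of the map \<open>S\<^sup>E \<rightarrow> K\<close> on the edge syzygies. So the rows
  of \<open>1 - w\<close> are relations and have no constant terms, while \<open>1 - w\<close> fixes every relation.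
\<close>
lemma edge_independent_if_splitting:
  fixes w :: "_ \<Rightarrow> _ \<Rightarrow> ('x::finite, 'k::field) polynomial"
  assumes T: "finite T" and E: "minimal_connected_below T E"
    and w: "\<And>e t. e \<in> E \<Longrightarrow> (\<Sum>e'\<in>E. w e e' * edge_syzygy e' t) = edge_syzygy e t"
    and rel: "\<And>l e'. (\<And>t. (\<Sum>e\<in>E. l e * edge_syzygy e t) = 0) \<Longrightarrow> e' \<in> E \<Longrightarrow> (\<Sum>e\<in>E. l e * w e e') = 0"
  shows "edge_independent TYPE('k) E"
  unfolding edge_independent_def
proof (intro allI impI ballI)
  fix l :: "_ \<Rightarrow> ('x, 'k) polynomial" and e
  assume l: "\<forall>t. (\<Sum>e\<in>E. l e * edge_syzygy e t) = 0" and e: "e \<in> E"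
  have fin: "finite E"
    using E T unfolding minimal_connected_below_def by (meson finite_SigmaI finite_subset)
  let ?n = "\<lambda>e e'. (if e' = e then 1 else 0) - w e e'"
  show "l e = 0"
  proof (rule eq_0_if_fixed_by_positive_degree_matrix[OF fin _ _ e, where n = ?n])
    show "l e' = (\<Sum>e\<in>E. l e * ?n e e')" if "e' \<in> E" for e'
      using rel[of l e'] l that fin
      by (simp add: right_diff_distrib sum_subtractf if_distrib[of "\<lambda>x. _ * x"] cong: if_cong)
    show "Poly_Mapping.lookup (?n e e') 0 = 0" if "e \<in> E" "e' \<in> E" for e e'
    proof (rule relation_constant_coeff_eq_0[OF T E _ that(2)])
      show "(\<Sum>e'\<in>E. ?n e e' * edge_syzygy e' t) = 0" for t
        using w[OF that(1), of t] fin that(1)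
        by (simp add: left_diff_distrib sum_subtractf if_distrib[of "\<lambda>x. x * _"] cong: if_cong)
    qed
  qed
qed

section \<open>Orderings of the generators\<close>

text \<open>
  The divisibility condition on an ordering of the generators, expressed by exponents.
\<close>
definition tree_ordering :: "('x::finite \<Rightarrow>\<^sub>0 nat) list \<Rightarrow> bool" where
  "tree_ordering us \<longleftrightarrow> (\<forall>k. 1 \<le> k \<and> k < length us \<longrightarrow>
     (\<exists>j<k. \<forall>i<k. us ! j \<preceq> exponent_max (us ! i) (us ! k)))"

text \<open>
  The list grows by one vertex at a time while its vertices stay connected among themselves. If the
  earlier end \<open>a\<close> of the edge to the new vertex \<open>b\<close> did not divide the least common multiple of \<open>b\<close>
  and an earlier \<open>i\<close>, the path from \<open>i\<close> to \<open>b\<close> below that multiple would avoid the edge, and so would a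
  path from \<open>a\<close> to \<open>i\<close> inside the list; together they contradict that the edge is a bridge.
\<close>
lemma ex_tree_ordering_if_forest:
  fixes T :: "('x::finite \<Rightarrow>\<^sub>0 nat) set"
  assumes T: "finite T" and conn: "connected_below T E" and ET: "E \<subseteq> T \<times> T" and forest: "forest E"
  shows "\<exists>us. distinct us \<and> set us = T \<and> tree_ordering us"
proof -
  have all: "(a, b) \<in> linked E" if "a \<in> T" "b \<in> T" for a b
  proof -
    have "(a, b) \<in> linked (edges_below E (a + b))"
      using conn that unfolding connected_below_def by simp
    then show ?thesis using linked_subset[of "edges_below E (a + b)" E] by (auto simp: edges_below_def)
  qed
  have "\<exists>us. distinct us \<and> length us = n \<and> set us \<subseteq> T \<and> tree_ordering us \<and>
      (\<forall>a\<in>set us. \<forall>b\<in>set us. (a, b) \<in> linked (E \<inter> set us \<times> set us))" if "n \<le> card T" for n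
    using that
  proof (induction n)
    case 0
    then show ?case by (auto simp: tree_ordering_def)
  next
    case (Suc n)
    then obtain us where us: "distinct us" "length us = n" "set us \<subseteq> T" "tree_ordering us"
      and link: "\<And>a b. a \<in> set us \<Longrightarrow> b \<in> set us \<Longrightarrow> (a, b) \<in> linked (E \<inter> set us \<times> set us)"
      by auto
    have "card (set us) < card T" using us Suc.prems by (simp add: distinct_card)
    then obtain y where y: "y \<in> T" "y \<notin> set us" using us(3) by (metis less_irrefl subsetI subset_antisym)
    show ?case
    proof (cases "us = []")
      case True
      then show ?thesis using y us(2) by (intro exI[of _ "[y]"]) (auto simp: tree_ordering_def)
    next
      case False
      then obtain x where x: "x \<in> set us" by (cases us) auto
      obtain a b where ab: "(a, b) \<in> E \<or> (b, a) \<in> E" "a \<in> set us" "b \<notin> set us"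
        using linked_crossing_edge[OF all, of x y "set us"] x y us(3) by blast
      have b: "b \<in> T" using ab(1) ET by auto
      have parent: "a \<preceq> exponent_max i b" if i: "i \<in> set us" for i
      proof (rule ccontr)
        assume not: "\<not> a \<preceq> exponent_max i b"
        obtain p q where e: "(p, q) \<in> E" "(p, q) = (a, b) \<or> (p, q) = (b, a)" using ab(1) by blast
        let ?E' = "E - {(p, q)}"
        have "edges_below E (exponent_max i b) \<subseteq> ?E'"
          using not e(2) by (auto simp: edges_below_def)
        moreover have "(i, b) \<in> linked (edges_below E (exponent_max i b))"
          using conn i us(3) b unfolding connected_below_def by auto
        ultimately have "(i, b) \<in> linked ?E'" using linked_subset by blast
        moreover have "E \<inter> set us \<times> set us \<subseteq> ?E'" using e(2) ab(3) by auto
        then have "(a, i) \<in> linked ?E'" using link[OF ab(2) i] linked_subset by blast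
        ultimately have "(a, b) \<in> linked ?E'" by (metis linked_trans)
        then have "(p, q) \<in> linked ?E'" using e(2) by (auto intro: linked_sym)
        then show False using forest e(1) unfolding forest_def by blast
      qed
      obtain j where j: "j < length us" "us ! j = a" using ab(2) by (auto simp: in_set_conv_nth)
      let ?us = "us @ [b]"
      have "tree_ordering ?us"
        unfolding tree_ordering_def
      proof (intro allI impI)
        fix k assume k: "1 \<le> k \<and> k < length ?us"
        show "\<exists>j<k. \<forall>i<k. ?us ! j \<preceq> exponent_max (?us ! i) (?us ! k)"
        proof (cases "k < length us")
          case True
          then obtain j' where "j' < k" "\<forall>i<k. us ! j' \<preceq> exponent_max (us ! i) (us ! k)"
            using us(4) k unfolding tree_ordering_def by blast
          then show ?thesis using True by (intro exI[of _ j']) (simp add: nth_append)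
        next
          case False
          then have "k = length us" using k by simp
          then show ?thesis using j parent by (intro exI[of _ j]) (simp add: nth_append)
        qed
      qed
      moreover have "(c, d) \<in> linked (E \<inter> set ?us \<times> set ?us)" if "c \<in> set ?us" "d \<in> set ?us" for c d
      proof -
        let ?F = "E \<inter> set ?us \<times> set ?us"
        have "linked (E \<inter> set us \<times> set us) \<subseteq> linked ?F" by (rule linked_subset) auto
        then have old: "(c, a) \<in> linked ?F" if "c \<in> set us" for c
          using link[OF that ab(2)] by blast
        have "(b, a) \<in> linked ?F" using ab by (auto intro: linked_edge)
        then have "(c, a) \<in> linked ?F" if "c \<in> set ?us" for c
          using old that by auto
        then show ?thesis using that by (meson linked_sym linked_trans)
      qed
      ultimately show ?thesis
        using us ab(3) b by (intro exI[of _ ?us]) auto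
    qed
  qed
  then obtain us where "distinct us" "length us = card T" "set us \<subseteq> T" "tree_ordering us" by blast
  then show ?thesis using T by (metis card_subset_eq distinct_card)
qed

text \<open>
  The edges join each vertex to an earlier parent. Connectedness below \<open>m\<close> goes by replacing the later
  of two vertices by its parent, which again divides \<open>m\<close>. For independence, the edge with the
  last child among those with nonzero coefficient is the only one to contribute to the coordinate of
  that child.
\<close>
lemma ex_independent_graph_if_tree_ordering:
  fixes us :: "('x::finite \<Rightarrow>\<^sub>0 nat) list"
  assumes dist: "distinct us" and ord: "tree_ordering us"
  shows "\<exists>E. E \<subseteq> set us \<times> set us \<and> connected_below (set us) E \<and> edge_independent TYPE('k::field) E"
proof -
  obtain p where p: "\<And>k. 1 \<le> k \<Longrightarrow> k < length us \<Longrightarrow>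
      p k < k \<and> (\<forall>i<k. us ! p k \<preceq> exponent_max (us ! i) (us ! k))"
    using ord unfolding tree_ordering_def by metis
  let ?e = "\<lambda>k. (us ! p k, us ! k)"
  define E where "E = ?e ` {1..<length us}"
  have inj: "inj_on ?e {1..<length us}"
    using dist by (auto intro!: inj_onI simp: nth_eq_iff_index_eq)
  have "E \<subseteq> set us \<times> set us"
    using p by (fastforce simp: E_def)
  moreover have "connected_below (set us) E"
    unfolding connected_below_def
  proof (intro allI ballI impI)
    fix m a b assume ab: "a \<in> set us" "b \<in> set us" "a \<preceq> m" "b \<preceq> m"
    have "(us ! i, us ! k) \<in> linked (edges_below E m)"
      if "k < length us" "i \<le> k" "us ! i \<preceq> m" "us ! k \<preceq> m" for i k
      using that
    proof (induction k arbitrary: i rule: less_induct)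
      case (less k)
      show ?case
      proof (cases "i = k")
        case False
        then have k: "1 \<le> k" "i < k" using less.prems by auto
        then have pk: "p k < k" "us ! p k \<preceq> exponent_max (us ! i) (us ! k)"
          using p less.prems(1) by auto
        have "exponent_max (us ! i) (us ! k) \<preceq> m"
          using less.prems by (simp add: exponent_max_divides_iff)
        then have pm: "us ! p k \<preceq> m" using pk divides_trans by blast
        have "(us ! p k, us ! k) \<in> edges_below E m"
          using k less.prems pm by (auto simp: edges_below_def E_def)
        moreover have "(us ! i, us ! p k) \<in> linked (edges_below E m)"
        proof (cases "i \<le> p k")
          case True
          show ?thesis using less.IH[OF pk(1) _ True] less.prems pk(1) pm by simp
        next
          case False
          have "(us ! p k, us ! i) \<in> linked (edges_below E m)"
            using less.IH[OF k(2), of "p k"] less.prems k(2) pm False by simp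
          then show ?thesis by (rule linked_sym)
        qed
        ultimately show ?thesis using linked_trans linked_edge by metis
      qed simp
    qed
    then show "(a, b) \<in> linked (edges_below E m)"
      using ab by (metis in_set_conv_nth linked_sym nle_le)
  qed
  moreover have "edge_independent TYPE('k) E"
    unfolding edge_independent_def
  proof (intro allI impI)
    fix c :: "_ \<Rightarrow> ('x, 'k) polynomial"
    assume rel: "\<forall>t. (\<Sum>e\<in>E. c e * edge_syzygy e t) = 0"
    have "c (?e k) = 0" if "1 \<le> k" "k < length us" for k
      using that
    proof (induction "length us - k" arbitrary: k rule: less_induct)
      case less
      have "0 = (\<Sum>e\<in>E. c e * edge_syzygy e (us ! k))" by (simp add: rel)
      also have "\<dots> = (\<Sum>i\<in>{1..<length us}. c (?e i) * edge_syzygy (?e i) (us ! k))"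
        unfolding E_def sum.reindex[OF inj] o_def ..
      also have "\<dots> = c (?e k) * edge_syzygy (?e k) (us ! k) +
          (\<Sum>i\<in>{1..<length us} - {k}. c (?e i) * edge_syzygy (?e i) (us ! k))"
        using less.prems by (intro sum.remove) auto
      also have "(\<Sum>i\<in>{1..<length us} - {k}. c (?e i) * edge_syzygy (?e i) (us ! k)) = 0"
      proof (rule sum.neutral, rule ballI)
        fix i assume i: "i \<in> {1..<length us} - {k}"
        show "c (?e i) * edge_syzygy (?e i) (us ! k) = 0"
        proof (cases "i < k")
          case True
          then have "us ! k \<noteq> us ! i" "us ! k \<noteq> us ! p i"
            using i p[of i] less.prems dist by (auto simp: nth_eq_iff_index_eq)
          then show ?thesis by (simp add: edge_syzygy_def pair_syzygy_def)
        next
          case False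
          then show ?thesis using less.hyps[of i] i by auto
        qed
      qed
      finally have eq: "c (?e k) * edge_syzygy (?e k) (us ! k) = 0" by simp
      have "us ! k \<noteq> us ! p k"
        using p[of k] less.prems dist by (auto simp: nth_eq_iff_index_eq)
      then have "edge_syzygy (?e k) (us ! k) =
          (- monomial (exponent_max (us ! p k) (us ! k) - us ! k) :: ('x, 'k) polynomial)"
        by (simp add: edge_syzygy_def pair_syzygy_def)
      then have "c (?e k) * monomial (exponent_max (us ! p k) (us ! k) - us ! k) = 0"
        using eq by simp
      then show ?case by (rule monomial_mult_eq_0)
    qed
    then show "\<forall>e\<in>E. c e = 0" by (auto simp: E_def)
  qed
  ultimately show ?thesis by blast
qed

section \<open>Resolutions over the polynomial ring\<close>

lemma polynomial_ring_simps [simp]: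
  "carrier polynomial_ring = UNIV" "mult polynomial_ring = (*)" "one polynomial_ring = 1"
  "zero polynomial_ring = 0" "add polynomial_ring = (+)"
  by (simp_all add: polynomial_ring_def)

lemma ideal_module_simps [simp]:
  "carrier (ideal_module R I) = I" "add (ideal_module R I) = add R"
  "zero (ideal_module R I) = zero R" "smult (ideal_module R I) = mult R"
  by (simp_all add: ideal_module_def)

lemma ideal_module_is_module:
  fixes A :: "('x::finite, 'k::field) polynomial set"
  shows "Module.module polynomial_ring (ideal_module polynomial_ring (Idl\<^bsub>polynomial_ring\<^esub> A))"
proof -
  interpret cring "polynomial_ring :: ('x, 'k) polynomial ring" by (rule cring_polynomial_ring)
  show ?thesis
    by (intro module_ideal_module[OF cring_polynomial_ring] genideal_ideal) simp
qed

lemma in_free_polynomial_module_iff: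
  assumes "finite X"
  shows "c \<in> carrier (free_module polynomial_ring X) \<longleftrightarrow> (\<forall>x. x \<notin> X \<longrightarrow> c x = 0)"
proof -
  have "(\<forall>x. x \<notin> X \<longrightarrow> c x = 0) \<longleftrightarrow> {x. c x \<noteq> 0} \<subseteq> X" by auto
  then show ?thesis
    using assms by (auto simp: free_module_simps intro: finite_subset)
qed

lemma matrix_linear_map:
  assumes "finite Y" "\<And>x z. x \<in> X \<Longrightarrow> z \<notin> Y \<Longrightarrow> W x z = 0"
  shows "(\<lambda>c z. \<Sum>x\<in>X. c (\<iota> x) * W x z)
    \<in> linear_maps polynomial_ring (free_module polynomial_ring Z) (free_module polynomial_ring Y)"
  by (rule linear_mapsI)
    (simp_all add: in_free_polynomial_module_iff[OF assms(1)] assms(2),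
     simp_all add: free_module_simps distrib_right sum.distrib sum_distrib_left mult.assoc)

lemma row_linear_map:
  assumes "\<And>c. (\<Sum>x\<in>X. c (\<iota> x) * u x) \<in> I"
  shows "(\<lambda>c. \<Sum>x\<in>X. c (\<iota> x) * u x)
    \<in> linear_maps polynomial_ring (free_module polynomial_ring Z) (ideal_module polynomial_ring I)"
  by (rule linear_mapsI)
    (simp_all add: assms,
     simp_all add: free_module_simps distrib_right sum.distrib sum_distrib_left mult.assoc)

lemma sum_unit_vector_polynomial:
  fixes W :: "'e \<Rightarrow> ('x::finite, 'k::field) polynomial"
  assumes "finite E" "e \<in> E"
  shows "(\<Sum>e'\<in>E. unit_vector polynomial_ring e e' * W e') = W e"
  using assms by (simp add: unit_vector_def if_distrib[of "\<lambda>x. x * _"] cong: if_cong)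

text \<open>
  The splitting over a finite presentation, written as a matrix of polynomials, so that no module
  structure is left in the conclusion.
\<close>
lemma splitting_if_projective_dimension_le_1:
  fixes u :: "'t \<Rightarrow> ('x::finite, 'k::field) polynomial" and s :: "'e \<Rightarrow> 't \<Rightarrow> ('x, 'k) polynomial"
  assumes T: "finite T" and E: "finite E"
    and I: "Module.module polynomial_ring (ideal_module polynomial_ring I)"
      "I = range (\<lambda>c. \<Sum>t\<in>T. c t * u t)"
    and s: "\<And>e t. e \<in> E \<Longrightarrow> t \<notin> T \<Longrightarrow> s e t = 0" "\<And>e. e \<in> E \<Longrightarrow> (\<Sum>t\<in>T. s e t * u t) = 0"
    and exact: "\<And>f. (\<And>t. t \<notin> T \<Longrightarrow> f t = 0) \<Longrightarrow> (\<Sum>t\<in>T. f t * u t) = 0 \<Longrightarrow>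
      \<exists>c. f = (\<lambda>t. \<Sum>e\<in>E. c e * s e t)"
    and pd: "projective_dimension polynomial_ring (ideal_module polynomial_ring I) \<le> 1"
  shows "\<exists>w. (\<forall>e\<in>E. \<forall>t. (\<Sum>e'\<in>E. w e e' * s e' t) = s e t) \<and>
    (\<forall>l. (\<forall>t. (\<Sum>e\<in>E. l e * s e t) = 0) \<longrightarrow> (\<forall>e'\<in>E. (\<Sum>e\<in>E. l e * w e e') = 0))"
proof -
  let ?R = "polynomial_ring :: ('x, 'k) polynomial ring"
  let ?F = "free_module ?R T" and ?A = "free_module ?R E" and ?M = "ideal_module ?R I"
  let ?q = "\<lambda>c. \<Sum>t\<in>T. c t * u t" and ?g = "\<lambda>c t. \<Sum>e\<in>E. c e * s e t"
  have mod: "Module.module ?R (free_module ?R Z)" for Z :: "'z set"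
    by (rule module_free_module[OF cring_polynomial_ring])
  have q: "?q \<in> linear_maps ?R ?F ?M"
    using row_linear_map[where \<iota> = "\<lambda>t. t" and X = T and u = u and I = I] I(2) by blast
  have "?q ` carrier ?F = carrier ?M"
  proof -
    have "?q c \<in> ?q ` carrier ?F" for c
    proof (rule image_eqI)
      show "?q c = ?q (\<lambda>t. if t \<in> T then c t else 0)" by (simp cong: sum.cong)
    qed (simp add: in_free_polynomial_module_iff[OF T])
    then show ?thesis using I(2) by auto
  qed
  moreover have g: "?g \<in> linear_maps ?R ?A ?F"
    using matrix_linear_map[OF T, where X = E and W = s and \<iota> = "\<lambda>e. e"] s(1) by blast
  have ker: "?g c \<in> a_kernel ?F ?M ?q" for c
  proof -
    have "?q (?g c) = (\<Sum>e\<in>E. c e * (\<Sum>t\<in>T. s e t * u t))"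
      by (simp add: sum_distrib_left sum_distrib_right mult.assoc) (rule sum.swap)
    then show ?thesis
      using s by (simp add: a_kernel_def' in_free_polynomial_module_iff[OF T])
  qed
  have g_image: "?g ` carrier ?A = a_kernel ?F ?M ?q"
  proof
    show "?g ` carrier ?A \<subseteq> a_kernel ?F ?M ?q" using ker by blast
    show "a_kernel ?F ?M ?q \<subseteq> ?g ` carrier ?A"
    proof
      fix f assume "f \<in> a_kernel ?F ?M ?q"
      then have "\<And>t. t \<notin> T \<Longrightarrow> f t = 0" "?q f = 0"
        by (auto simp: a_kernel_def' in_free_polynomial_module_iff[OF T])
      then obtain c where c: "f = ?g c" using exact by blast
      then have "f = ?g (\<lambda>e. if e \<in> E then c e else 0)" by (simp cong: sum.cong)
      then show "f \<in> ?g ` carrier ?A"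
        by (rule image_eqI[where f = ?g]) (simp add: in_free_polynomial_module_iff[OF E])
    qed
  qed
  ultimately obtain \<sigma> where \<sigma>: "\<sigma> \<in> linear_maps ?R (?F\<lparr>carrier := a_kernel ?F ?M ?q\<rparr>) ?A"
    and split: "\<And>x. x \<in> a_kernel ?F ?M ?q \<Longrightarrow> ?g (\<sigma> x) = x"
    using kernel_splits_if_projective_dimension_le_1[OF I(1) pd
        projective_free_module[OF cring_polynomial_ring] q _ mod g g_image] by blast
  have g': "?g \<in> linear_maps ?R ?A (?F\<lparr>carrier := a_kernel ?F ?M ?q\<rparr>)"
    by (rule linear_mapsI) (simp_all add: ker linear_mapsD[OF g])
  define w where "w e = \<sigma> (s e)" for e
  have unit: "unit_vector ?R e \<in> carrier ?A" "?g (unit_vector ?R e) = s e" if "e \<in> E" for e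
    using that by (auto simp: in_free_polynomial_module_iff[OF E] sum_unit_vector_polynomial[OF E])
      (auto simp: unit_vector_def)
  have s_ker: "s e \<in> a_kernel ?F ?M ?q" if "e \<in> E" for e
    using ker[of "unit_vector ?R e"] unit(2)[OF that] by simp
  have w_in: "w e \<in> carrier ?A" if "e \<in> E" for e
    unfolding w_def using linear_mapsD(1)[OF \<sigma>] s_ker[OF that] by simp
  have h: "(\<lambda>l e'. \<Sum>e\<in>E. l e * w e e') \<in> linear_maps ?R ?A ?A"
    using matrix_linear_map[OF E, where X = E and W = w and \<iota> = "\<lambda>e. e"] w_in in_free_polynomial_module_iff[OF E] by blast
  \<comment> \<open>Both sides are linear in \<open>l\<close>, so it suffices to compare them on the basis.\<close>
  have eq: "\<sigma> (?g l) = (\<lambda>e'. \<Sum>e\<in>E. l e * w e e')" if "l \<in> carrier ?A" for l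
  proof (rule linear_maps_eq_if_eq_on_unit_vectors[OF mod linear_maps_comp[OF g' \<sigma>] h _ that])
    fix e assume e: "e \<in> E"
    show "\<sigma> (?g (unit_vector ?R e)) = (\<lambda>e'. \<Sum>e''\<in>E. unit_vector ?R e e'' * w e'' e')"
      unfolding unit(2)[OF e] by (simp add: sum_unit_vector_polynomial[OF E e] w_def)
  qed
  show ?thesis
  proof (intro exI conjI ballI allI impI)
    show "(\<Sum>e'\<in>E. w e e' * s e' t) = s e t" if "e \<in> E" for e t
      using fun_cong[OF split[OF s_ker[OF that]], of t] by (simp add: w_def)
  next
    fix l e' assume l: "\<forall>t. (\<Sum>e\<in>E. l e * s e t) = 0" and e': "e' \<in> E"
    let ?l = "\<lambda>e. if e \<in> E then l e else 0"
    have gl: "?g ?l = ?g (\<lambda>_. 0)" using l by (simp cong: sum.cong)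
    have in_A: "?l \<in> carrier ?A" "(\<lambda>_. 0) \<in> carrier ?A"
      by (simp_all add: in_free_polynomial_module_iff[OF E])
    have "(\<lambda>e'. \<Sum>e\<in>E. ?l e * w e e') = \<sigma> (?g ?l)" by (rule eq[OF in_A(1), symmetric])
    also have "\<dots> = \<sigma> (?g (\<lambda>_. 0))" by (rule arg_cong[OF gl])
    also have "\<dots> = (\<lambda>e'. \<Sum>e\<in>E. 0 * w e e')" by (rule eq[OF in_A(2)])
    finally have "(\<Sum>e\<in>E. ?l e * w e e') = (\<Sum>e\<in>E. 0 * w e e')" by (rule fun_cong)
    then show "(\<Sum>e\<in>E. l e * w e e') = 0"
      by (simp cong: sum.cong)
  qed
qed

lemma ex_inj_on_into_product:
  assumes "finite X" shows "\<exists>\<iota> :: 'i \<Rightarrow> 'b \<times> nat. inj_on \<iota> X"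
proof -
  obtain f :: "'i \<Rightarrow> nat" where "inj_on f X"
    using finite_imp_inj_to_nat_seg[OF assms] by blast
  then have "inj_on (\<lambda>i. (undefined, f i)) X" by (simp add: inj_on_def)
  then show ?thesis by blast
qed

text \<open>
  The modules of a resolution in \<open>projective_dimension\<close> consist of functions on pairs of a
  polynomial and a number. The index sets \<open>T\<close> and \<open>E\<close> are therefore first embedded into that type.
\<close>
lemma projective_dimension_le_1_if_presentation:
  fixes u :: "'t \<Rightarrow> ('x::finite, 'k::field) polynomial" and s :: "'e \<Rightarrow> 't \<Rightarrow> ('x, 'k) polynomial"
  assumes T: "finite T" and E: "finite E"
    and I: "I = range (\<lambda>c. \<Sum>t\<in>T. c t * u t)"
    and s: "\<And>e t. e \<in> E \<Longrightarrow> t \<notin> T \<Longrightarrow> s e t = 0" "\<And>e. e \<in> E \<Longrightarrow> (\<Sum>t\<in>T. s e t * u t) = 0"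
    and exact: "\<And>f. (\<And>t. t \<notin> T \<Longrightarrow> f t = 0) \<Longrightarrow> (\<Sum>t\<in>T. f t * u t) = 0 \<Longrightarrow>
      \<exists>c. f = (\<lambda>t. \<Sum>e\<in>E. c e * s e t)"
    and indep: "\<And>c e. (\<And>t. (\<Sum>e\<in>E. c e * s e t) = 0) \<Longrightarrow> e \<in> E \<Longrightarrow> c e = 0"
  shows "projective_dimension polynomial_ring (ideal_module polynomial_ring I) \<le> 1"
proof -
  let ?R = "polynomial_ring :: ('x, 'k) polynomial ring"
  let ?M = "ideal_module ?R I"
  obtain \<iota> :: "'t \<Rightarrow> ('x, 'k) polynomial \<times> nat" where \<iota>: "inj_on \<iota> T"
    using ex_inj_on_into_product[OF T] by blast
  obtain \<kappa> :: "'e \<Rightarrow> ('x, 'k) polynomial \<times> nat" where \<kappa>: "inj_on \<kappa> E"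
    using ex_inj_on_into_product[OF E] by blast
  define X where "X i = (if i = 0 then \<iota> ` T else if i = 1 then \<kappa> ` E else {})" for i :: nat
  have X: "finite (X i)" "X 0 = \<iota> ` T" "X (Suc 0) = \<kappa> ` E" "X (Suc (Suc i)) = {}" for i
    using T E by (simp_all add: X_def)
  define P where "P i = free_module ?R (X i)" for i
  define W where "W e z = (if z \<in> \<iota> ` T then s e (inv_into T \<iota> z) else 0)" for e z
  let ?\<epsilon> = "\<lambda>c. \<Sum>t\<in>T. c (\<iota> t) * u t" and ?d = "\<lambda>c z. \<Sum>e\<in>E. c (\<kappa> e) * W e z"
  define \<delta> where "\<delta> i = (if i = 0 then ?d else (\<lambda>_ _. 0))" for i :: nat
  have W: "W e (\<iota> t) = s e t" if "t \<in> T" for e t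
    using that \<iota> by (simp add: W_def)
  have P: "c \<in> carrier (P i) \<longleftrightarrow> (\<forall>z. z \<notin> X i \<longrightarrow> c z = 0)" for c i
    unfolding P_def by (rule in_free_polynomial_module_iff[OF X(1)])
  have P_zero: "zero (P i) = (\<lambda>_. 0)" for i by (simp add: P_def free_module_simps)
  have P_trivial: "carrier (P (Suc (Suc i))) = {\<zero>\<^bsub>P (Suc (Suc i))\<^esub>}" for i
    unfolding P_zero by (auto simp: P X)
  have lift: "\<exists>c. c \<in> carrier (free_module ?R (f ` S)) \<and> (\<forall>x\<in>S. c (f x) = b x)"
    if "inj_on f S" "finite S" for f :: "'z \<Rightarrow> ('x, 'k) polynomial \<times> nat" and S b
    using that
    by (intro exI[of _ "\<lambda>z. if z \<in> f ` S then b (inv_into S f z) else 0"])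
      (simp add: in_free_polynomial_module_iff)
  have \<epsilon>: "?\<epsilon> \<in> linear_maps ?R (P 0) ?M"
    unfolding P_def by (rule row_linear_map) (use I in auto)
  have "projective_resolution ?R ?M P \<delta> ?\<epsilon>"
    unfolding projective_resolution_def
  proof (intro conjI allI)
    show "projective_module ?R (P i)" for i
      unfolding P_def by (rule projective_free_module[OF cring_polynomial_ring])
    show "?\<epsilon> \<in> linear_maps ?R (P 0) ?M" by fact
    show "\<delta> i \<in> linear_maps ?R (P (Suc i)) (P i)" for i
    proof (cases "i = 0")
      case True
      then show ?thesis
        unfolding P_def \<delta>_def using matrix_linear_map[OF X(1), of E 0 W \<kappa>] by (simp add: X(2) W_def)
    next
      case False
      then show ?thesis
        by (intro linear_mapsI) (simp_all add: \<delta>_def P, simp_all add: P_def free_module_simps)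
    qed
    show "?\<epsilon> ` carrier (P 0) = carrier ?M"
    proof
      show "?\<epsilon> ` carrier (P 0) \<subseteq> carrier ?M" using linear_mapsD(1)[OF \<epsilon>] by blast
      show "carrier ?M \<subseteq> ?\<epsilon> ` carrier (P 0)"
      proof
        fix p assume "p \<in> carrier ?M"
        then obtain b where b: "p = (\<Sum>t\<in>T. b t * u t)" using I by auto
        obtain c where c: "c \<in> carrier (P 0)" "\<forall>t\<in>T. c (\<iota> t) = b t"
          using lift[OF \<iota> T, of b] by (auto simp: P_def X)
        then have "p = ?\<epsilon> c" using b by (simp cong: sum.cong)
        then show "p \<in> ?\<epsilon> ` carrier (P 0)" using c(1) by blast
      qed
    qed
    show "\<delta> 0 ` carrier (P 1) = a_kernel (P 0) ?M ?\<epsilon>"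
    proof
      show "\<delta> 0 ` carrier (P 1) \<subseteq> a_kernel (P 0) ?M ?\<epsilon>"
      proof
        fix z assume "z \<in> \<delta> 0 ` carrier (P 1)"
        then obtain c where z: "z = ?d c" by (auto simp: \<delta>_def)
        have "?\<epsilon> z = (\<Sum>t\<in>T. \<Sum>e\<in>E. c (\<kappa> e) * (s e t * u t))"
          by (simp add: z W sum_distrib_right mult.assoc cong: sum.cong)
        also have "\<dots> = (\<Sum>e\<in>E. c (\<kappa> e) * (\<Sum>t\<in>T. s e t * u t))"
          unfolding sum_distrib_left by (rule sum.swap)
        finally have "?\<epsilon> z = 0" using s(2) by simp
        then show "z \<in> a_kernel (P 0) ?M ?\<epsilon>"
          by (simp add: a_kernel_def' P X z W_def)
      qed
      show "a_kernel (P 0) ?M ?\<epsilon> \<subseteq> \<delta> 0 ` carrier (P 1)"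
      proof
        fix z assume "z \<in> a_kernel (P 0) ?M ?\<epsilon>"
        then have z: "z \<in> carrier (P 0)" "?\<epsilon> z = 0" by (auto simp: a_kernel_def')
        obtain b where b: "(\<lambda>t. if t \<in> T then z (\<iota> t) else 0) = (\<lambda>t. \<Sum>e\<in>E. b e * s e t)"
          using exact[of "\<lambda>t. if t \<in> T then z (\<iota> t) else 0"] z(2) by (auto cong: sum.cong)
        obtain c where c: "c \<in> carrier (P 1)" "\<forall>e\<in>E. c (\<kappa> e) = b e"
          using lift[OF \<kappa> E, of b] by (auto simp: P_def X)
        have "z y = ?d c y" for y
        proof (cases "y \<in> \<iota> ` T")
          case True
          then obtain t where "t \<in> T" "y = \<iota> t" by blast
          then show ?thesis using fun_cong[OF b, of t] c(2) by (simp add: W cong: sum.cong)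
        next
          case False
          moreover have "\<forall>y. y \<notin> \<iota> ` T \<longrightarrow> z y = 0" using z(1) unfolding P X .
          ultimately show ?thesis by (simp add: W_def del: split_paired_All)
        qed
        then have "z = \<delta> 0 c" by (auto simp: \<delta>_def)
        then show "z \<in> \<delta> 0 ` carrier (P 1)" using c(1) by blast
      qed
    qed
    have d_ker: "c = (\<lambda>_. 0)" if c: "c \<in> carrier (P 1)" and "?d c = (\<lambda>_. 0)" for c
    proof -
      have "(\<Sum>e\<in>E. c (\<kappa> e) * s e t) = 0" for t
      proof (cases "t \<in> T")
        case True
        then show ?thesis using fun_cong[OF that(2), of "\<iota> t"] by (simp add: W)
      qed (simp add: s(1))
      then have "\<forall>e\<in>E. c (\<kappa> e) = 0" using indep[of "\<lambda>e. c (\<kappa> e)"] by blast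
      then have "c z = 0" for z using c by (cases "z \<in> \<kappa> ` E") (auto simp: P X simp del: split_paired_All)
      then show ?thesis by auto
    qed
    show "\<delta> (Suc i) ` carrier (P (Suc (Suc i))) = a_kernel (P (Suc i)) (P i) (\<delta> i)" for i
    proof -
      have "\<delta> (Suc i) ` carrier (P (Suc (Suc i))) = {\<lambda>_. 0}"
        unfolding P_trivial by (simp add: \<delta>_def)
      moreover have "a_kernel (P (Suc i)) (P i) (\<delta> i) = {\<lambda>_. 0}"
      proof (cases i)
        case 0
        have "(\<lambda>_. 0) \<in> a_kernel (P 1) (P 0) (\<delta> 0)"
          by (simp add: a_kernel_def' P P_zero \<delta>_def)
        moreover have "c = (\<lambda>_. 0)" if "c \<in> a_kernel (P 1) (P 0) (\<delta> 0)" for c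
          using that d_ker[of c] by (simp add: a_kernel_def' P_zero \<delta>_def)
        ultimately show ?thesis unfolding 0 One_nat_def[symmetric] by blast
      next
        case (Suc j)
        then show ?thesis using P_trivial[of j] by (auto simp: a_kernel_def' P_zero \<delta>_def)
      qed
      ultimately show ?thesis by simp
    qed
  qed
  moreover have "\<forall>i>1. carrier (P i) = {\<zero>\<^bsub>P i\<^esub>}"
  proof (intro allI impI)
    fix i :: nat assume "1 < i"
    then obtain j where "i = Suc (Suc j)" by (cases i; cases "i - 1") auto
    then show "carrier (P i) = {\<zero>\<^bsub>P i\<^esub>}" using P_trivial[of j] by (simp only:)
  qed
  ultimately show ?thesis
    unfolding one_enat_def projective_dimension_le_iff by (intro exI conjI)
qed

section \<open>Ideals generated by monomials\<close>

lemma ideal_generated_by_finitely_many_monomials: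
  fixes T :: "('x::finite \<Rightarrow>\<^sub>0 nat) set"
  assumes "finite T"
  shows "Idl\<^bsub>polynomial_ring\<^esub> (monomial ` T :: ('x, 'k::field) polynomial set) =
    range (\<lambda>c. \<Sum>t\<in>T. c t * monomial t)" (is "_ = ?R")
  unfolding ideal_generated_by_monomials
proof
  show "?R \<subseteq> {f. \<forall>s\<in>Poly_Mapping.keys f. \<exists>t\<in>T. \<exists>d. s = t + d}"
  proof (clarify)
    fix c :: "_ \<Rightarrow> ('x, 'k) polynomial" and s
    assume "s \<in> Poly_Mapping.keys (\<Sum>t\<in>T. c t * monomial t)"
    then have "(\<Sum>t\<in>T. Poly_Mapping.lookup (c t * monomial t) s) \<noteq> 0"
      by (simp add: in_keys_iff lookup_sum)
    then obtain t where t: "t \<in> T" "Poly_Mapping.lookup (c t * monomial t) s \<noteq> 0"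
      by (rule sum.not_neutral_contains_not_neutral)
    then have "t \<preceq> s" by (auto simp: lookup_monomial_mult split: if_splits)
    then show "\<exists>t\<in>T. \<exists>d. s = t + d" using t(1) by (auto simp: divides_iff_ex_add)
  qed
  have zero: "0 \<in> ?R" by (rule image_eqI[of _ _ "\<lambda>_. 0"]) simp_all
  have add: "f + g \<in> ?R" if fg: "f \<in> ?R" "g \<in> ?R" for f g
  proof -
    obtain c d where "f = (\<Sum>t\<in>T. c t * monomial t)" "g = (\<Sum>t\<in>T. d t * monomial t)"
      using fg by auto
    then show ?thesis
      by (intro image_eqI[of _ _ "\<lambda>t. c t + d t"]) (simp_all add: distrib_right sum.distrib)
  qed
  show "{f. \<forall>s\<in>Poly_Mapping.keys f. \<exists>t\<in>T. \<exists>d. s = t + d} \<subseteq> ?R"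
  proof (clarify)
    fix f :: "('x, 'k) polynomial"
    assume f: "\<forall>s\<in>Poly_Mapping.keys f. \<exists>t\<in>T. \<exists>d. s = t + d"
    have single: "Poly_Mapping.single s a \<in> ?R" if s: "s \<in> Poly_Mapping.keys f" for s a
    proof -
      obtain t d where t: "t \<in> T" "s = t + d" using f s by blast
      have "(\<Sum>t'\<in>T. (if t' = t then Poly_Mapping.single d a else 0) * monomial t') =
          Poly_Mapping.single d a * monomial t"
        using assms t(1) by (simp add: if_distrib[of "\<lambda>x. x * _"] cong: if_cong)
      also have "\<dots> = Poly_Mapping.single s a"
        by (simp add: monomial_def mult_single t(2) add.commute)
      finally show ?thesis by (intro image_eqI[OF sym]) simp_all
    qed
    have partial_sum: "(\<Sum>s\<in>K. Poly_Mapping.single s (Poly_Mapping.lookup f s)) \<in> ?R"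
      if "finite K" "K \<subseteq> Poly_Mapping.keys f" for K
      using that by (induction K) (auto simp: zero intro!: add single simp del: image_iff)
    have "(\<Sum>s\<in>Poly_Mapping.keys f. Poly_Mapping.single s (Poly_Mapping.lookup f s)) \<in> ?R"
      by (rule partial_sum) simp_all
    moreover have "(\<Sum>s\<in>Poly_Mapping.keys f. Poly_Mapping.single s (Poly_Mapping.lookup f s)) = f"
      by (rule poly_mapping_eqI) (simp add: lookup_sum lookup_single when_def in_keys_iff)
    ultimately show "f \<in> ?R" by (simp only:)
  qed
qed

lemma sum_edge_syzygy_mult_monomial:
  assumes "finite T" "E \<subseteq> T \<times> T" "e \<in> E"
  shows "(\<Sum>t\<in>T. edge_syzygy e t * monomial t) = (0 :: ('x::finite, 'k::field) polynomial)"
proof -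
  have "fst e \<in> T" "snd e \<in> T" using assms by auto
  then show ?thesis using assms(1) by (simp add: edge_syzygy_def sum_pair_syzygy)
qed

lemma edge_syzygy_outside:
  assumes "E \<subseteq> T \<times> T" "e \<in> E" "t \<notin> T" shows "edge_syzygy e t = 0"
  using assms by (auto simp: edge_syzygy_def pair_syzygy_def)

lemma projective_dimension_le_1_iff_tree_ordering:
  fixes T :: "('x::finite \<Rightarrow>\<^sub>0 nat) set"
  assumes T: "finite T"
  defines "I \<equiv> Idl\<^bsub>polynomial_ring\<^esub> (monomial ` T :: ('x, 'k::field) polynomial set)"
  shows "projective_dimension polynomial_ring (ideal_module polynomial_ring I) \<le> 1 \<longleftrightarrow>
    (\<exists>us. distinct us \<and> set us = T \<and> tree_ordering us)"
proof
  have I: "I = range (\<lambda>c. \<Sum>t\<in>T. c t * monomial t)"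
    unfolding I_def by (rule ideal_generated_by_finitely_many_monomials[OF T])
  have exact: "\<exists>c. f = (\<lambda>t. \<Sum>e\<in>E. c e * edge_syzygy e t)"
    if "E \<subseteq> T \<times> T" "connected_below T E" "\<And>t. t \<notin> T \<Longrightarrow> f t = 0" "(\<Sum>t\<in>T. f t * monomial t) = 0"
    for E and f :: "_ \<Rightarrow> ('x, 'k) polynomial"
  proof -
    have "finite E" using that(1) T by (meson finite_SigmaI finite_subset)
    then show ?thesis using syzygy_in_edge_span[OF T _ that(2-4)] by (simp add: edge_span_def)
  qed
  {
    assume pd: "projective_dimension polynomial_ring (ideal_module polynomial_ring I) \<le> 1"
    obtain E where E: "minimal_connected_below T E" using ex_minimal_connected_below[OF T] by blast
    then have ET: "E \<subseteq> T \<times> T" and conn: "connected_below T E"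
      by (auto simp: minimal_connected_below_def)
    have fin: "finite E" using ET T by (meson finite_SigmaI finite_subset)
    have mod: "Module.module polynomial_ring (ideal_module polynomial_ring I)"
      unfolding I_def by (rule ideal_module_is_module)
    obtain w :: "_ \<Rightarrow> _ \<Rightarrow> ('x, 'k) polynomial"
      where "\<forall>e\<in>E. \<forall>t. (\<Sum>e'\<in>E. w e e' * edge_syzygy e' t) = edge_syzygy e t"
      and "\<forall>l. (\<forall>t. (\<Sum>e\<in>E. l e * edge_syzygy e t) = 0) \<longrightarrow> (\<forall>e'\<in>E. (\<Sum>e\<in>E. l e * w e e') = 0)"
      using splitting_if_projective_dimension_le_1[OF T fin mod I edge_syzygy_outside[OF ET]
            sum_edge_syzygy_mult_monomial[OF T ET] exact[OF ET conn] pd] by blast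
    then have "edge_independent TYPE('k) E" by (intro edge_independent_if_splitting[OF T E, where w = w]) blast+
    then show "\<exists>us. distinct us \<and> set us = T \<and> tree_ordering us"
      by (rule ex_tree_ordering_if_forest[OF T conn ET forest_if_edge_independent[OF fin]])
  next
    assume "\<exists>us. distinct us \<and> set us = T \<and> tree_ordering us"
    then obtain us where us: "distinct us" "set us = T" "tree_ordering us" by blast
    obtain E where ET: "E \<subseteq> T \<times> T" and conn: "connected_below T E"
      and ind: "edge_independent TYPE('k) E"
      using ex_independent_graph_if_tree_ordering[OF us(1,3), where 'k = 'k] us(2) by blast
    have fin: "finite E" using ET T by (meson finite_SigmaI finite_subset)
    show "projective_dimension polynomial_ring (ideal_module polynomial_ring I) \<le> 1"
    proof (rule projective_dimension_le_1_if_presentation[OF T fin I, where s = edge_syzygy])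
      show "c e = 0" if "\<And>t. (\<Sum>e\<in>E. c e * edge_syzygy e t) = 0" "e \<in> E"
        for c :: "_ \<Rightarrow> ('x, 'k) polynomial" and e
        using ind that unfolding edge_independent_def by blast
    qed (use edge_syzygy_outside[OF ET] sum_edge_syzygy_mult_monomial[OF T ET] exact[OF ET conn] in auto)
  }
qed

text \<open>
  A section of the surjection \<open>S\<^sup>T \<rightarrow> I\<close> sends the generators \<open>x\<^sup>a\<close> and \<open>x\<^sup>b\<close> to vectors \<open>f\<close> and
  \<open>g\<close> with \<open>x\<^sup>b f = x\<^sup>a g\<close>. As no other generator divides \<open>x\<^sup>a\<close>, the constant term of \<open>f\<^sub>a\<close> is \<open>1\<close>;
  then \<open>x\<^sup>b\<close> occurs in \<open>x\<^sup>b f\<^sub>a = x\<^sup>a g\<^sub>a\<close>, which makes \<open>x\<^sup>a\<close> divide \<open>x\<^sup>b\<close>.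
\<close>
lemma projective_dimension_ne_0:
  fixes T :: "('x::finite \<Rightarrow>\<^sub>0 nat) set"
  assumes T: "finite T" and anti: "\<And>s t. s \<in> T \<Longrightarrow> t \<in> T \<Longrightarrow> s \<preceq> t \<Longrightarrow> s = t"
    and ab: "a \<in> T" "b \<in> T" "a \<noteq> b"
  defines "I \<equiv> Idl\<^bsub>polynomial_ring\<^esub> (monomial ` T :: ('x, 'k::field) polynomial set)"
  shows "projective_dimension polynomial_ring (ideal_module polynomial_ring I) \<noteq> 0"
proof
  assume pd: "projective_dimension polynomial_ring (ideal_module polynomial_ring I) = 0"
  let ?R = "polynomial_ring :: ('x, 'k) polynomial ring"
  let ?F = "free_module ?R T" and ?M = "ideal_module ?R I"
  let ?q = "\<lambda>c. \<Sum>t\<in>T. c t * monomial t"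
  have I: "I = range ?q"
    unfolding I_def by (rule ideal_generated_by_finitely_many_monomials[OF T])
  have q: "?q \<in> linear_maps ?R ?F ?M"
    using row_linear_map[where \<iota> = "\<lambda>t. t" and X = T and u = monomial and I = I] I by blast
  have "?q ` carrier ?F = carrier ?M"
  proof -
    have "?q c \<in> ?q ` carrier ?F" for c
    proof (rule image_eqI)
      show "?q c = ?q (\<lambda>t. if t \<in> T then c t else 0)" by (simp cong: sum.cong)
    qed (simp add: in_free_polynomial_module_iff[OF T])
    then show ?thesis using I by auto
  qed
  moreover have mod: "Module.module ?R ?M" unfolding I_def by (rule ideal_module_is_module)
  ultimately obtain \<sigma> where \<sigma>: "\<sigma> \<in> linear_maps ?R ?M ?F" and split: "\<And>x. x \<in> I \<Longrightarrow> ?q (\<sigma> x) = x"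
    using surjection_splits_if_projective_dimension_0[OF mod pd
        module_free_module[OF cring_polynomial_ring] q] by auto
  have mem: "monomial t \<in> I" if "t \<in> T" for t
    unfolding I_def ideal_generated_by_monomials using that
    by (auto simp: monomial_def intro!: exI[of _ 0])
  let ?f = "\<sigma> (monomial a)" and ?g = "\<sigma> (monomial b)"
  have hom: "\<sigma> (p * x) = (\<lambda>t. p * \<sigma> x t)" if "x \<in> I" for p x
    using linear_mapsD(3)[OF \<sigma>, of p x] that by (simp add: free_module_simps)
  have "(\<lambda>t. monomial b * ?f t) = (\<lambda>t. monomial a * ?g t)"
    using hom[OF mem[OF ab(1)], of "monomial b"] hom[OF mem[OF ab(2)], of "monomial a"]
    by (simp add: mult.commute)
  from fun_cong[OF this, of a]
  have comm: "?f a * monomial b = ?g a * monomial a" by (simp add: mult.commute)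
  have "1 = Poly_Mapping.lookup (?q ?f) a"
    using split[OF mem[OF ab(1)]] by (simp add: lookup_monomial)
  also have "\<dots> = (\<Sum>t\<in>T. if t = a then Poly_Mapping.lookup (?f a) 0 else 0)"
    unfolding lookup_sum
    by (intro sum.cong) (use anti ab in \<open>auto simp: lookup_monomial_mult\<close>)
  also have "\<dots> = Poly_Mapping.lookup (?f a * monomial b) b"
    using T ab by (simp add: lookup_monomial_mult)
  also have "\<dots> = 0"
    unfolding comm using anti ab by (auto simp: lookup_monomial_mult)
  finally show False by simp
qed

section \<open>Colon ideals and the three equivalent conditions\<close>

lemma colon_ideal_generated_by_monomials:
  fixes V :: "('x::finite \<Rightarrow>\<^sub>0 nat) set"
  shows "colon_ideal polynomial_ring (Idl\<^bsub>polynomial_ring\<^esub> (monomial ` V)) (monomial t) =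
    {f :: ('x, 'k::field) polynomial. \<forall>s\<in>Poly_Mapping.keys f. \<exists>v\<in>V. v \<preceq> s + t}"
proof -
  have "Poly_Mapping.keys (f * monomial t) = (\<lambda>s. s + t) ` Poly_Mapping.keys f"
    for f :: "('x, 'k) polynomial"
  proof (rule Set.set_eqI)
    fix m
    have "m \<in> Poly_Mapping.keys (f * monomial t) \<longleftrightarrow> t \<preceq> m \<and> m - t \<in> Poly_Mapping.keys f"
      by (simp add: in_keys_iff lookup_monomial_mult)
    also have "\<dots> \<longleftrightarrow> m \<in> (\<lambda>s. s + t) ` Poly_Mapping.keys f"
      using divides_diff_add[of t m] by (auto simp: image_iff) metis
    finally show "m \<in> Poly_Mapping.keys (f * monomial t) \<longleftrightarrow> m \<in> (\<lambda>s. s + t) ` Poly_Mapping.keys f" .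
  qed
  then show ?thesis
    by (simp add: colon_ideal_def ideal_generated_by_monomials divides_iff_ex_add)
qed

text \<open>
  A monomial lies in the colon ideal if and only if one of the quotients of \<open>lcm(v, t)\<close> by \<open>t\<close>, for
  \<open>v \<in> V\<close>, divides it. A single generator must therefore be one of these quotients and divide all of
  them.
\<close>
lemma colon_ideal_principal_iff:
  fixes V :: "('x::finite \<Rightarrow>\<^sub>0 nat) set"
  shows "(\<exists>w\<in>monomials. colon_ideal polynomial_ring (Idl\<^bsub>polynomial_ring\<^esub> (monomial ` V)) (monomial t) =
      Idl\<^bsub>polynomial_ring\<^esub> {w :: ('x, 'k::field) polynomial}) \<longleftrightarrow>
    (\<exists>u\<in>V. \<forall>v\<in>V. u \<preceq> exponent_max v t)" (is "?l \<longleftrightarrow> ?r")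
proof -
  have principal: "Idl\<^bsub>polynomial_ring\<^esub> {monomial w} =
      {f :: ('x, 'k) polynomial. \<forall>s\<in>Poly_Mapping.keys f. w \<preceq> s}" for w :: "'x \<Rightarrow>\<^sub>0 nat"
    using ideal_generated_by_monomials[of "{w}", where 'k = 'k] by (simp add: divides_iff_ex_add)
  have "colon_ideal polynomial_ring (Idl\<^bsub>polynomial_ring\<^esub> (monomial ` V)) (monomial t) =
      Idl\<^bsub>polynomial_ring\<^esub> {monomial w :: ('x, 'k) polynomial} \<longleftrightarrow>
      (\<forall>s. (\<exists>v\<in>V. v \<preceq> s + t) \<longleftrightarrow> w \<preceq> s)" (is "?C = ?P \<longleftrightarrow> ?eq") for w
  proof
    assume eq: "?C = ?P"
    have keys: "Poly_Mapping.keys (monomial s :: ('x, 'k) polynomial) = {s}" for s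
      by (simp add: monomial_def)
    have "monomial s \<in> ?C \<longleftrightarrow> monomial s \<in> ?P" for s using eq by simp
    then show ?eq
      unfolding colon_ideal_generated_by_monomials principal by (simp add: keys)
  next
    assume ?eq
    then show "?C = ?P" unfolding colon_ideal_generated_by_monomials principal by simp
  qed
  then have "?l \<longleftrightarrow> (\<exists>w. \<forall>s. (\<exists>v\<in>V. v \<preceq> s + t) \<longleftrightarrow> w \<preceq> s)"
    by (simp add: monomials_def)
  also have "\<dots> \<longleftrightarrow> ?r"
  proof
    assume "\<exists>w. \<forall>s. (\<exists>v\<in>V. v \<preceq> s + t) \<longleftrightarrow> w \<preceq> s"
    then obtain w where w: "\<And>s. (\<exists>v\<in>V. v \<preceq> s + t) \<longleftrightarrow> w \<preceq> s" by blast
    obtain u where u: "u \<in> V" "u \<preceq> w + t" using w[of w] by auto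
    have "u \<preceq> exponent_max v t" if "v \<in> V" for v
    proof -
      have "v \<preceq> exponent_max v t - t + t" by (simp add: divides_diff_add)
      then have "w \<preceq> exponent_max v t - t" using w that by blast
      then have "w + t \<preceq> exponent_max v t - t + t" by (simp add: divides_def lookup_add)
      then show ?thesis using u(2) divides_trans by (simp add: divides_diff_add) blast
    qed
    then show ?r using u(1) by blast
  next
    assume ?r
    then obtain u where u: "u \<in> V" "\<And>v. v \<in> V \<Longrightarrow> u \<preceq> exponent_max v t" by blast
    have "(\<exists>v\<in>V. v \<preceq> s + t) \<longleftrightarrow> exponent_max u t - t \<preceq> s" for s
    proof -
      have "exponent_max u t - t \<preceq> s \<longleftrightarrow> u \<preceq> s + t"
        by (simp add: divides_diff_iff exponent_max_divides_iff)
      moreover have "u \<preceq> s + t" if "v \<in> V" "v \<preceq> s + t" for v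
        using divides_trans[OF u(2)[OF that(1)]] that(2) by (simp add: exponent_max_divides_iff)
      ultimately show ?thesis using u(1) by blast
    qed
    then show "\<exists>w. \<forall>s. (\<exists>v\<in>V. v \<preceq> s + t) \<longleftrightarrow> w \<preceq> s" by blast
  qed
  finally show ?thesis .
qed

lemma minimal_generators_antichain:
  fixes T :: "('x::finite \<Rightarrow>\<^sub>0 nat) set" and I :: "('x, 'k::field) polynomial set"
  assumes "minimal_monomial_generating_set I (monomial ` T)"
    and "s \<in> T" "t \<in> T" "s \<preceq> t"
  shows "s = t"
proof (rule ccontr)
  assume "s \<noteq> t"
  have "monomial ` (T - {t}) \<subset> (monomial ` T :: ('x, 'k) polynomial set)"
  proof (rule psubsetI)
    have "monomial t \<notin> (monomial ` (T - {t}) :: ('x, 'k) polynomial set)"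
      by (simp add: inj_image_mem_iff[OF inj_monomial])
    then show "monomial ` (T - {t}) \<noteq> (monomial ` T :: ('x, 'k) polynomial set)"
      using assms(3) by blast
  qed blast
  then have ne: "Idl\<^bsub>polynomial_ring\<^esub> (monomial ` (T - {t})) \<noteq> I" and I: "Idl\<^bsub>polynomial_ring\<^esub> (monomial ` T) = I"
    using assms(1) unfolding minimal_monomial_generating_set_def by blast+
  have "(\<exists>v\<in>T. v \<preceq> m) \<longleftrightarrow> (\<exists>v\<in>T - {t}. v \<preceq> m)" for m
    using assms(2-4) \<open>s \<noteq> t\<close> by (metis DiffE DiffI divides_trans singletonD)
  then have "Idl\<^bsub>polynomial_ring\<^esub> (monomial ` (T - {t})) = (Idl\<^bsub>polynomial_ring\<^esub> (monomial ` T) :: ('x, 'k) polynomial set)"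
    unfolding ideal_generated_by_monomials divides_iff_ex_add[symmetric] by simp
  then show False using ne I by simp
qed

theorem theorem2p5:
  fixes I :: "('x::finite, 'k::field) polynomial set"
  assumes "monomial_ideal I"
    and "card (minimal_monomial_generators I) \<ge> 2"
  shows
    "(projective_dimension polynomial_ring (ideal_module polynomial_ring I) = 1 \<longleftrightarrow>
      (\<exists>u. distinct u \<and> set u = minimal_monomial_generators I \<and>
        (\<forall>k. 1 \<le> k \<and> k < length u \<longrightarrow>
          (\<exists>j<k. \<forall>i<k. u ! j dvd monomial_lcm (u ! i) (u ! k))))) \<and>
     (projective_dimension polynomial_ring (ideal_module polynomial_ring I) = 1 \<longleftrightarrow>
      (\<exists>u. distinct u \<and> set u = minimal_monomial_generators I \<and>
        (\<forall>k. 1 \<le> k \<and> k < length u \<longrightarrow>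
          (\<exists>w\<in>monomials.
            colon_ideal polynomial_ring (Idl\<^bsub>polynomial_ring\<^esub> (set (take k u))) (u ! k) =
              Idl\<^bsub>polynomial_ring\<^esub> {w}))))"
proof -
  let ?mon = "monomial :: _ \<Rightarrow> ('x, 'k) polynomial"
  let ?G = "minimal_monomial_generators I"
  let ?pd = "projective_dimension polynomial_ring (ideal_module polynomial_ring I)"
  have G: "minimal_monomial_generating_set I ?G"
    unfolding minimal_monomial_generators_def
    by (rule theI'[OF ex1_minimal_monomial_generating_set[OF assms(1)]])
  then obtain T where GT: "?G = ?mon ` T"
    unfolding minimal_monomial_generating_set_def monomials_def by (meson subset_imageE)
  have inj: "inj_on ?mon S" for S using inj_monomial by (rule inj_on_subset) simp
  have "finite ?G" using assms(2) by (intro card_ge_0_finite) simp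
  then have T: "finite T" unfolding GT by (rule finite_imageD) (rule inj)
  have I: "I = Idl\<^bsub>polynomial_ring\<^esub> (?mon ` T)"
    using G unfolding GT minimal_monomial_generating_set_def by simp
  have anti: "s = t" if "s \<in> T" "t \<in> T" "s \<preceq> t" for s t
    using minimal_generators_antichain[OF G[unfolded GT] that] .
  have "card T \<ge> 2" using assms(2) unfolding GT card_image[OF inj] .
  then obtain a b where ab: "a \<in> T" "b \<in> T" "a \<noteq> b"
    by (metis card_le_Suc0_iff_eq[OF T] not_less_eq_eq numeral_2_eq_2)
  have "?pd \<noteq> 0"
    unfolding I by (rule projective_dimension_ne_0[OF T anti ab])
  then have "?pd = 1 \<longleftrightarrow> ?pd \<le> 1"
    using ileI1[of 0 ?pd] by (auto simp: one_eSuc)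
  also have "\<dots> \<longleftrightarrow> (\<exists>us. distinct us \<and> set us = T \<and> tree_ordering us)"
    unfolding I by (rule projective_dimension_le_1_iff_tree_ordering[OF T])
  finally have pd: "?pd = 1 \<longleftrightarrow> (\<exists>us. distinct us \<and> set us = T \<and> tree_ordering us)" .
  have transfer: "(\<exists>u. distinct u \<and> set u = ?G \<and> Q u) \<longleftrightarrow> (\<exists>us. distinct us \<and> set us = T \<and> tree_ordering us)"
    if Q: "\<And>us. Q (map ?mon us) \<longleftrightarrow> tree_ordering us" for Q
  proof
    assume "\<exists>u. distinct u \<and> set u = ?G \<and> Q u"
    then obtain u where u: "distinct u" "set u = ?mon ` T" "Q u" unfolding GT by blast
    have "\<forall>p\<in>set u. \<exists>t. p = ?mon t" using u(2) by blast
    then obtain us where us: "u = map ?mon us" unfolding ex_map_conv[symmetric] by blast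
    moreover have "set us = T"
      using u(2) us by (simp add: inj_image_eq_iff[OF inj_monomial])
    ultimately show "\<exists>us. distinct us \<and> set us = T \<and> tree_ordering us"
      using u Q[of us] by (auto simp: distinct_map)
  next
    assume "\<exists>us. distinct us \<and> set us = T \<and> tree_ordering us"
    then obtain us where us: "distinct us" "set us = T" "tree_ordering us" by blast
    then show "\<exists>u. distinct u \<and> set u = ?G \<and> Q u"
      using Q[of us] inj by (intro exI[of _ "map ?mon us"]) (simp add: distinct_map GT)
  qed
  let ?Q2 = "\<lambda>u :: ('x, 'k) polynomial list. \<forall>k. 1 \<le> k \<and> k < length u \<longrightarrow>
    (\<exists>j<k. \<forall>i<k. u ! j dvd monomial_lcm (u ! i) (u ! k))"
  let ?Q3 = "\<lambda>u :: ('x, 'k) polynomial list. \<forall>k. 1 \<le> k \<and> k < length u \<longrightarrow>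
    (\<exists>w\<in>monomials. colon_ideal polynomial_ring (Idl\<^bsub>polynomial_ring\<^esub> (set (take k u))) (u ! k) =
      Idl\<^bsub>polynomial_ring\<^esub> {w})"
  have Q2: "?Q2 (map ?mon us) \<longleftrightarrow> tree_ordering us" for us
    unfolding tree_ordering_def
    by (simp add: monomial_lcm_monomial monomial_dvd_iff cong: conj_cong)
  have Q3: "?Q3 (map ?mon us) \<longleftrightarrow> tree_ordering us" for us
  proof -
    have "(\<exists>w\<in>monomials. colon_ideal polynomial_ring
          (Idl\<^bsub>polynomial_ring\<^esub> (set (take k (map ?mon us)))) (map ?mon us ! k) = Idl\<^bsub>polynomial_ring\<^esub> {w}) \<longleftrightarrow>
        (\<exists>j<k. \<forall>i<k. us ! j \<preceq> exponent_max (us ! i) (us ! k))" (is "?lhs \<longleftrightarrow> _")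
      if k: "k < length us" for k
    proof -
      have "set (take k (map ?mon us)) = ?mon ` ((!) us ` {..<k})"
        using k by (simp add: nth_image[symmetric] take_map lessThan_atLeast0)
      moreover have "map ?mon us ! k = ?mon (us ! k)" using k by simp
      ultimately have "?lhs \<longleftrightarrow> (\<exists>u\<in>(!) us ` {..<k}. \<forall>v\<in>(!) us ` {..<k}. u \<preceq> exponent_max v (us ! k))"
        by (simp only: colon_ideal_principal_iff)
      then show ?thesis by auto
    qed
    then show ?thesis unfolding tree_ordering_def by simp
  qed
  show ?thesis
    unfolding pd transfer[of ?Q2, OF Q2] transfer[of ?Q3, OF Q3] by simp
qed

end
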